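(* Let $G=F_{m,n}$ be the fan graph on $n+m$ vertices, $n\ge2$, $m\ge 1$, let $\mathbb{K}$ be a field and let $R$ be the polynomial ring over $\mathbb{K}$ whose variables are the vertices of $G$. Then $\beta_{i,\mathbf{a}}^R(R/I(G))\le 2$ for all $i\ge1$ and $\mathbf{a}\in\mathbb{N}^{n+m}$.
   Context: For a graph $H$, $U\subseteq V(H)$ and a new vertex $x$, $x*_U H$ is the graph with vertex set $V(H)\cup\{x\}$ and edge set $E(H)\cup\{\{x,u\}:u\in U\}$. With $P_n$ the path on $n$ vertices and $U=V(P_n)$, the fan graph is $F_{m,n}=x_1*_U(\cdots*_U(x_m*_U P_n))$ (each of the $m$ distinct new vertices $x_i$ is joined exactly to the vertices of $P_n$). $I(G)=(uv:\{u,v\}\in E(G))\subset R$ is the edge ideal. $R$ is multigraded by $\mathbb{N}^{n+m}$, each variable having degree the corresponding standard basis vector, and $\beta_{i,\mathbf{a}}^R$ are the multigraded Betti numbers. *)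

theory Defs
  imports "HOL.Hull" "HOL-Library.Poly_Mapping"
begin

subsection \<open>Polynomial rings and ideals\<close>

text \<open>
  A monomial is a finitely supported exponent vector, a polynomial a finitely supported
  coefficient function on monomials. The type \<open>('v, 'k) poly_over\<close> has a variable for every element
  of \<open>'v\<close>; the ring \<open>K[x\<^sub>v : v \<in> V]\<close> is the subset \<open>polys V\<close>, and every notion
  below is relative to \<open>V\<close>. The exponent vectors supported in \<open>V\<close> are also the multidegrees.
\<close>

type_synonym ('v, 'k) poly_over = "('v \<Rightarrow>\<^sub>0 nat) \<Rightarrow>\<^sub>0 'k"

definition multidegrees :: "'v set \<Rightarrow> ('v \<Rightarrow>\<^sub>0 nat) set" where
  "multidegrees V = {a. Poly_Mapping.keys a \<subseteq> V}"

definition polys :: "'v set \<Rightarrow> ('v, 'k::field) poly_over set" where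
  "polys V = {p. Poly_Mapping.keys p \<subseteq> multidegrees V}"

definition var :: "'v \<Rightarrow> ('v, 'k::field) poly_over" where
  "var v = Poly_Mapping.single (Poly_Mapping.single v 1) 1"

definition is_ideal :: "'v set \<Rightarrow> ('v, 'k::field) poly_over set \<Rightarrow> bool" where
  "is_ideal V J \<longleftrightarrow> J \<subseteq> polys V \<and> 0 \<in> J \<and> (\<forall>f\<in>J. \<forall>g\<in>J. f + g \<in> J) \<and>
     (\<forall>r\<in>polys V. \<forall>f\<in>J. r * f \<in> J)"

definition ideal_gen :: "'v set \<Rightarrow> ('v, 'k::field) poly_over set \<Rightarrow> ('v, 'k) poly_over set" where
  "ideal_gen V S = (is_ideal V) hull S"

definition max_ideal :: "'v set \<Rightarrow> ('v, 'k::field) poly_over set" where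
  "max_ideal V = ideal_gen V (var ` V)"

subsection \<open>Minimal multigraded free resolutions and Betti numbers\<close>

text \<open>
  With \<open>R = polys V\<close>, a record \<open>F\<close> describes the maps
  \<open>\<dots> \<rightarrow> F\<^sub>2 \<rightarrow> F\<^sub>1 \<rightarrow> F\<^sub>0 \<rightarrow> R/I\<close>, where \<open>F\<^sub>i\<close> is free with basis
  \<open>e\<^sub>k\<close> for \<open>k < rk F i\<close>, the basis element \<open>e\<^sub>k\<close> having multidegree \<open>shift F i k\<close>, so that
  \<open>F\<^sub>i\<close> is the direct sum of the modules \<open>R(-shift F i k)\<close>.
  The entry \<open>dmat F i j k\<close> is the coefficient of \<open>e\<^sub>j\<close> in the image of \<open>e\<^sub>k\<close> under
  the differential from \<open>F\<close> in homological degree \<open>i + 1\<close> to \<open>F\<close> in degree \<open>i\<close>,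
  and \<open>aug F j\<close> is a representative of the image of \<open>e\<^sub>j\<close> in \<open>R/I\<close>. As \<open>I\<close> is homogeneous,
  homogeneous elements of \<open>R/I\<close> have homogeneous representatives.
\<close>

record (overloaded) ('v, 'k) free_complex =
  rk :: "nat \<Rightarrow> nat"
  shift :: "nat \<Rightarrow> nat \<Rightarrow> ('v \<Rightarrow>\<^sub>0 nat)"
  dmat :: "nat \<Rightarrow> nat \<Rightarrow> nat \<Rightarrow> ('v, 'k) poly_over"
  aug :: "nat \<Rightarrow> ('v, 'k) poly_over"

definition free_mod :: "'v set \<Rightarrow> nat \<Rightarrow> (nat \<Rightarrow> ('v, 'k::field) poly_over) set" where
  "free_mod V r = {f. (\<forall>k<r. f k \<in> polys V) \<and> (\<forall>k\<ge>r. f k = 0)}"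

definition diff_map :: "('v, 'k::field) free_complex \<Rightarrow> nat \<Rightarrow>
    (nat \<Rightarrow> ('v, 'k) poly_over) \<Rightarrow> (nat \<Rightarrow> ('v, 'k) poly_over)" where
  "diff_map F i f = (\<lambda>j. if j < rk F i then \<Sum>k<rk F (Suc i). dmat F i j k * f k else 0)"

definition aug_map :: "('v, 'k::field) free_complex \<Rightarrow>
    (nat \<Rightarrow> ('v, 'k) poly_over) \<Rightarrow> ('v, 'k) poly_over" where
  "aug_map F f = (\<Sum>j<rk F 0. aug F j * f j)"

text \<open>
  All maps preserve the multidegree: a monomial \<open>t\<close> occurring in the matrix entry at
  \<open>(j, k)\<close> has degree equal to that of \<open>e\<^sub>k\<close> minus that of \<open>e\<^sub>j\<close>.
\<close>

definition multigraded :: "'v set \<Rightarrow> ('v, 'k::field) free_complex \<Rightarrow> bool" where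
  "multigraded V F \<longleftrightarrow>
     (\<forall>i. \<forall>k<rk F i. shift F i k \<in> multidegrees V) \<and>
     (\<forall>i. \<forall>j<rk F i. \<forall>k<rk F (Suc i). dmat F i j k \<in> polys V \<and>
        (\<forall>t\<in>Poly_Mapping.keys (dmat F i j k). shift F i j + t = shift F (Suc i) k)) \<and>
     (\<forall>j<rk F 0. aug F j \<in> polys V \<and> (\<forall>t\<in>Poly_Mapping.keys (aug F j). t = shift F 0 j))"

definition resolves_quotient ::
    "'v set \<Rightarrow> ('v, 'k::field) poly_over set \<Rightarrow> ('v, 'k) free_complex \<Rightarrow> bool" where
  "resolves_quotient V I F \<longleftrightarrow>
     (\<forall>p\<in>polys V. \<exists>f\<in>free_mod V (rk F 0). p - aug_map F f \<in> I) \<and>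
     {f \<in> free_mod V (rk F 0). aug_map F f \<in> I} = diff_map F 0 ` free_mod V (rk F 1) \<and>
     (\<forall>i. {f \<in> free_mod V (rk F (Suc i)). diff_map F i f = (\<lambda>_. 0)} =
        diff_map F (Suc i) ` free_mod V (rk F (Suc (Suc i))))"

definition minimal_free_resolution ::
    "'v set \<Rightarrow> ('v, 'k::field) poly_over set \<Rightarrow> ('v, 'k) free_complex \<Rightarrow> bool" where
  "minimal_free_resolution V I F \<longleftrightarrow> multigraded V F \<and> resolves_quotient V I F \<and>
     (\<forall>i. \<forall>j<rk F i. \<forall>k<rk F (Suc i). dmat F i j k \<in> max_ideal V)"

text \<open>
  The number \<open>\<beta>\<^sub>i\<^sub>,\<^sub>a(R/I)\<close> of summands \<open>R(-a)\<close> in homological degree \<open>i\<close> of a minimal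
  multigraded free resolution of \<open>R/I\<close>. For \<open>V\<close> finite and \<open>I\<close> generated by monomials such a
  resolution exists and is unique up to isomorphism, so the choice does not matter.
\<close>

definition betti :: "'v set \<Rightarrow> ('v, 'k::field) poly_over set \<Rightarrow> nat \<Rightarrow> ('v \<Rightarrow>\<^sub>0 nat) \<Rightarrow> nat" where
  "betti V I i a = (let F = (SOME F. minimal_free_resolution V I F)
     in card {k. k < rk F i \<and> shift F i k = a})"

subsection \<open>Graphs, edge ideals and fan graphs\<close>

record 'v ugraph =
  verts :: "'v set"
  edges :: "'v set set"

definition edge_ideal :: "'v ugraph \<Rightarrow> ('v, 'k::field) poly_over set" where
  "edge_ideal G = ideal_gen (verts G) {var u * var v | u v. {u, v} \<in> edges G}"

text \<open>The graph \<open>x *\<^sub>U H\<close>, meaningful for \<open>x \<notin> verts H\<close> and \<open>U \<subseteq> verts H\<close>.\<close>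

definition join_vertex :: "'v \<Rightarrow> 'v set \<Rightarrow> 'v ugraph \<Rightarrow> 'v ugraph" where
  "join_vertex x U H = \<lparr>verts = insert x (verts H), edges = edges H \<union> {{x, u} | u. u \<in> U}\<rparr>"

datatype fan_vertex = Apex nat | Path nat

definition path_graph :: "nat \<Rightarrow> fan_vertex ugraph" where
  "path_graph n = \<lparr>verts = Path ` {1..n}, edges = {{Path i, Path (Suc i)} | i. 1 \<le> i \<and> i < n}\<rparr>"

definition fan_graph :: "nat \<Rightarrow> nat \<Rightarrow> fan_vertex ugraph" where
  "fan_graph m n =
     foldr (\<lambda>i. join_vertex (Apex i) (verts (path_graph n))) [1..<Suc m] (path_graph n)"

end

theory Submission
  imports Defs
begin

text \<open>
  Multigraded complexes are treated degree by degree as complexes of finite-dimensional vector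
  spaces. If \<open>C\<close> resolves \<open>R/I\<close> and \<open>D\<close> resolves \<open>R/(I : f)\<close> for a monomial \<open>f\<close>, then the mapping cone
  of a chain map \<open>D(-f) \<rightarrow> C\<close> lifting multiplication by \<open>f\<close> resolves \<open>R/(I + (f))\<close>, and it is minimal
  as soon as no multidegree occurs in the same position of \<open>C\<close> and of \<open>D(-f)\<close>. The ideal of the fan
  is built from \<open>0\<close> by adjoining first the products \<open>x\<^sub>k y\<^sub>l\<close> in lexicographic order and then the path
  edges \<open>y\<^sub>j y\<^sub>j\<^sub>+\<^sub>1\<close>. All colon ideals that occur are generated by variables and the edges of a shorter
  path, and their Betti numbers in a fixed multidegree are at most one, as are those of the complete
  bipartite graph; hence the bound two. That any minimal resolution has these Betti numbers follows by
  comparing it with the constructed one.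
\<close>

subsection \<open>Divisibility of monomials\<close>

text \<open>Each cone adds at most one to the count in a given multidegree, so the n - 1 path edges
  might be expected to accumulate. They do not: the shifts contributed by y_j y_(j+1) involve
  y_(j+1) and no later path vertex, so the largest path index in a multidegree singles out the only
  path edge that can contribute to it. Two is one from the complete bipartite part plus one from
  that edge. The obstacle is minimality, since the two complexes being glued do share multidegrees
  and only the homological position can separate them. Linearity of the bipartite resolution does
  this: its shifts in position i >= 1 have total degree i + 1, whereas a shift of R/(I : f) in
  position i has total degree at least i, and twisting by the quadratic monomial f raises this by
  two. The characteristic of the field never enters.\<close>

definition mdvd :: "('v \<Rightarrow>\<^sub>0 nat) \<Rightarrow> ('v \<Rightarrow>\<^sub>0 nat) \<Rightarrow> bool" (infix \<open>\<preceq>\<close> 50) where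
  "a \<preceq> b \<longleftrightarrow> (\<forall>v. Poly_Mapping.lookup a v \<le> Poly_Mapping.lookup b v)"

lemma mdvd_refl [simp]: "a \<preceq> a"
  by (simp add: mdvd_def)

lemma mdvd_trans: "a \<preceq> b \<Longrightarrow> b \<preceq> c \<Longrightarrow> a \<preceq> c"
  unfolding mdvd_def using order_trans by blast

lemma mdvd_antisym: "a \<preceq> b \<Longrightarrow> b \<preceq> a \<Longrightarrow> a = b"
  unfolding mdvd_def by (intro poly_mapping_eqI) (simp add: order_antisym)

lemma zero_mdvd [simp]: "0 \<preceq> a"
  by (simp add: mdvd_def)

lemma mdvd_add [simp]: "a \<preceq> b + a" "a \<preceq> a + b"
  by (simp_all add: mdvd_def lookup_add)

lemma mdvd_add_mono: "a \<preceq> b \<Longrightarrow> a + c \<preceq> b + c"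
  by (simp add: mdvd_def lookup_add)

lemma mdvd_diff_add: "a \<preceq> b \<Longrightarrow> b - a + a = b"
  by (intro poly_mapping_eqI) (simp add: mdvd_def lookup_add lookup_minus)

text \<open>Exponents are subtracted with truncation at zero, so \<open>f \<preceq> a\<close> has to
  be recorded separately; it reappears as the case distinction in \<open>twist_iff\<close> and
  \<open>cone_betti\<close>.\<close>

lemma add_mdvd_iff: "s + f \<preceq> a \<longleftrightarrow> f \<preceq> a \<and> s \<preceq> a - f"
proof -
  have "x + y \<le> z \<longleftrightarrow> y \<le> z \<and> x \<le> z - y" for x y z :: nat
    by arith
  then show ?thesis
    by (auto simp: mdvd_def lookup_add lookup_minus)
qed

lemma mdvd_diff_diff:
  assumes "r \<preceq> s" "r \<preceq> a"
  shows "s - r \<preceq> a - r \<longleftrightarrow> s \<preceq> a" "s \<preceq> a \<Longrightarrow> a - r - (s - r) = a - s"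
proof -
  show "s - r \<preceq> a - r \<longleftrightarrow> s \<preceq> a"
    using assms add_mdvd_iff[of "s - r" r a] by (simp add: mdvd_diff_add)
  show "s \<preceq> a \<Longrightarrow> a - r - (s - r) = a - s"
    using assms by (intro poly_mapping_eqI) (simp add: mdvd_def lookup_minus)
qed

lemma multidegrees_mdvd: "a \<preceq> b \<Longrightarrow> b \<in> multidegrees V \<Longrightarrow> a \<in> multidegrees V"
  unfolding multidegrees_def mdvd_def subset_iff in_keys_iff mem_Collect_eq
  by (metis bot_nat_0.extremum_uniqueI)

lemma multidegrees_diff: "b \<in> multidegrees V \<Longrightarrow> b - a \<in> multidegrees V"
  by (rule multidegrees_mdvd) (auto simp: mdvd_def lookup_minus)

lemma multidegrees_add: "a \<in> multidegrees V \<Longrightarrow> b \<in> multidegrees V \<Longrightarrow> a + b \<in> multidegrees V"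
  unfolding multidegrees_def using keys_add[of a b] by auto

lemma zero_in_multidegrees [simp]: "0 \<in> multidegrees V"
  by (simp add: multidegrees_def)

subsection \<open>Linear maps given by columns\<close>

text \<open>\<open>W k\<close> is the image of the \<open>k\<close>-th basis vector. Storing columns
  allows lifts to be chosen one basis element at a time, and composition applies the outer map to
  each column (\<open>lin_lin\<close>).\<close>

definition lin :: "nat \<Rightarrow> (nat \<Rightarrow> nat \<Rightarrow> 'k::field) \<Rightarrow> (nat \<Rightarrow> 'k) \<Rightarrow> nat \<Rightarrow> 'k" where
  "lin n W v = (\<lambda>j. \<Sum>k<n. v k * W k j)"

lemma lin_zero [simp]: "lin n W (\<lambda>_. 0) = (\<lambda>_. 0)"
  by (simp add: lin_def)

lemma lin_lin: "lin n W (lin m X v) = lin m (\<lambda>k. lin n W (X k)) v"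
proof
  fix j
  have "lin n W (lin m X v) j = (\<Sum>k<n. \<Sum>l<m. v l * X l k * W k j)"
    by (simp add: lin_def sum_distrib_right)
  also have "\<dots> = (\<Sum>l<m. \<Sum>k<n. v l * X l k * W k j)"
    by (rule sum.swap)
  finally show "lin n W (lin m X v) j = lin m (\<lambda>k. lin n W (X k)) v j"
    by (simp add: lin_def sum_distrib_left mult.assoc)
qed

lemma lin_add: "lin n W (\<lambda>j. u j + v j) = (\<lambda>j. lin n W u j + lin n W v j)"
  by (simp add: lin_def distrib_right sum.distrib)

lemma lin_diff: "lin n W (\<lambda>j. u j - v j) = (\<lambda>j. lin n W u j - lin n W v j)"
  by (simp add: lin_def left_diff_distrib sum_subtractf)

lemma lin_uminus: "lin n W (\<lambda>j. - v j) = (\<lambda>j. - lin n W v j)"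
  by (simp add: lin_def sum_negf)

lemma lin_cols_diff: "lin n (\<lambda>k j. W k j - X k j) v = (\<lambda>j. lin n W v j - lin n X v j)"
  by (simp add: lin_def right_diff_distrib sum_subtractf)

lemma lin_cong: "(\<And>k. k < n \<Longrightarrow> v k \<noteq> 0 \<Longrightarrow> W k = X k) \<Longrightarrow> lin n W v = lin n X v"
proof (unfold lin_def, intro ext sum.cong refl)
  fix j k assume *: "\<And>k. k < n \<Longrightarrow> v k \<noteq> 0 \<Longrightarrow> W k = X k" and "k \<in> {..<n}"
  then have "v k = 0 \<or> W k = X k"
    by blast
  then show "v k * W k j = v k * X k j"
    by auto
qed

definition unit_vec :: "nat \<Rightarrow> nat \<Rightarrow> 'k::field" where
  "unit_vec k = (\<lambda>j. if j = k then 1 else 0)"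

lemma lin_unit_cols: "(\<And>j. v j \<noteq> 0 \<Longrightarrow> j < n) \<Longrightarrow> lin n unit_vec v = v"
proof (rule ext)
  fix j
  assume "\<And>j. v j \<noteq> 0 \<Longrightarrow> j < n"
  then have "j < n \<or> v j = 0"
    by blast
  then show "lin n unit_vec v j = v j"
    by (auto simp: lin_def unit_vec_def if_distrib[of "(*) _"] cong: if_cong)
qed

lemma lin_unit_vec: "k < n \<Longrightarrow> lin n W (unit_vec k) = W k"
  unfolding lin_def unit_vec_def
  by (rule ext) (simp add: if_distrib[where f = "\<lambda>x. x * _"] cong: if_cong)

section \<open>A rank inequality by elimination\<close>

text \<open>Gaussian elimination, one equation per induction step; \<open>P k l\<close> is the
  coefficient of the unknown \<open>k\<close> in the equation \<open>l\<close>.\<close>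

lemma nontrivial_solution:
  fixes P :: "'a \<Rightarrow> 'b \<Rightarrow> 'k::field"
  assumes "finite B" "finite A" "card B < card A"
  shows "\<exists>x. (\<exists>k\<in>A. x k \<noteq> 0) \<and> (\<forall>l\<in>B. (\<Sum>k\<in>A. x k * P k l) = 0)"
  using assms
proof (induction B arbitrary: A P rule: finite_induct)
  case empty
  then obtain k where "k \<in> A"
    by fastforce
  then show ?case
    by (intro exI[of _ "\<lambda>_. 1"]) auto
next
  case (insert b B)
  show ?case
  proof (cases "\<forall>k\<in>A. P k b = 0")
    case True
    obtain x where "\<exists>k\<in>A. x k \<noteq> 0" "\<forall>l\<in>B. (\<Sum>k\<in>A. x k * P k l) = 0"
      using insert.IH[of A P] insert.prems insert.hyps by auto
    with True show ?thesis
      by (intro exI[of _ x]) auto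
  next
    case False
    then obtain p where p: "p \<in> A" "P p b \<noteq> 0"
      by blast
    \<comment> \<open>The unknown \<open>p\<close> is eliminated by means of equation
      \<open>b\<close>, whose coefficients in \<open>P'\<close> all vanish; its value in
      \<open>y\<close> below is the one that equation \<open>b\<close> forces.\<close>
    define P' where "P' = (\<lambda>k l. P k l - P k b / P p b * P p l)"
    have "card B < card (A - {p})"
      using insert.prems insert.hyps p by simp
    then obtain x where x: "\<exists>k\<in>A - {p}. x k \<noteq> 0"
      "\<forall>l\<in>B. (\<Sum>k\<in>A - {p}. x k * P' k l) = 0"
      using insert.IH[of "A - {p}" P'] insert.prems by auto
    define y where "y = x(p := - (\<Sum>k\<in>A - {p}. x k * P k b) / P p b)"
    have y: "(\<Sum>k\<in>A. y k * P k l) = (\<Sum>k\<in>A - {p}. x k * P' k l)" for l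
    proof -
      have "(\<Sum>k\<in>A. y k * P k l) = y p * P p l + (\<Sum>k\<in>A - {p}. y k * P k l)"
        using insert.prems p by (simp add: sum.remove)
      also have "(\<Sum>k\<in>A - {p}. y k * P k l) = (\<Sum>k\<in>A - {p}. x k * P k l)"
        by (intro sum.cong) (auto simp: y_def)
      also have "y p * P p l = - (\<Sum>k\<in>A - {p}. x k * (P k b / P p b * P p l))"
        by (simp add: y_def sum_distrib_right sum_divide_distrib mult.assoc)
      finally show ?thesis
        by (simp add: P'_def right_diff_distrib sum_subtractf)
    qed
    have "P' k b = 0" for k
      using p by (simp add: P'_def)
    with x y have "\<forall>l\<in>insert b B. (\<Sum>k\<in>A. y k * P k l) = 0"
      by simp
    moreover have "\<exists>k\<in>A. y k \<noteq> 0"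
      using x(1) by (auto simp: y_def)
    ultimately show ?thesis
      by blast
  qed
qed

text \<open>With fewer columns than rows, some nonzero row vector is killed by \<open>P\<close>,
  hence by the product of \<open>P\<close> and \<open>Q\<close>, which is the identity on
  \<open>A\<close>.\<close>

lemma card_le_of_left_inverse:
  fixes P :: "'a \<Rightarrow> 'b \<Rightarrow> 'k::field"
  assumes "finite A" "finite B"
    and inv: "\<And>k j. k \<in> A \<Longrightarrow> j \<in> A \<Longrightarrow> (\<Sum>l\<in>B. P k l * Q l j) = (if j = k then 1 else 0)"
  shows "card A \<le> card B"
proof (rule ccontr)
  assume "\<not> card A \<le> card B"
  then obtain x k where x: "k \<in> A" "x k \<noteq> 0" "\<forall>l\<in>B. (\<Sum>k\<in>A. x k * P k l) = 0"
    using nontrivial_solution[of B A P] assms(1,2) by auto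
  have "0 = (\<Sum>l\<in>B. (\<Sum>i\<in>A. x i * P i l) * Q l k)"
    using x(3) by simp
  also have "\<dots> = (\<Sum>l\<in>B. \<Sum>i\<in>A. x i * (P i l * Q l k))"
    by (simp add: sum_distrib_right mult.assoc)
  also have "\<dots> = (\<Sum>i\<in>A. \<Sum>l\<in>B. x i * (P i l * Q l k))"
    by (rule sum.swap)
  also have "\<dots> = (\<Sum>i\<in>A. x i * (if k = i then 1 else 0))"
    using inv x(1) by (simp add: sum_distrib_left[symmetric])
  also have "\<dots> = x k"
    using x(1) assms(1) by (simp add: if_distrib cong: if_cong)
  finally show False
    using x(2) by simp
qed

subsection \<open>Multigraded complexes with scalar entries\<close>

text \<open>
  A multigraded differential is determined by scalars, since the entry at a pair of basis elements
  is a scalar times the monomial prescribed by the shifts. In degree \<open>a\<close> the free module in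
  position \<open>i\<close> becomes the finite-dimensional space \<open>homog C i a\<close>; \<open>scol C i k\<close> is the image of the
  \<open>k\<close>-th basis element of position \<open>i + 1\<close>. The set \<open>U\<close> below consists of the monomials of the
  ideal, so that the quotient ring has dimension at most one in each degree.
\<close>

record (overloaded) ('v, 'k) scalar_complex =
  srk :: "nat \<Rightarrow> nat"
  ssh :: "nat \<Rightarrow> nat \<Rightarrow> ('v \<Rightarrow>\<^sub>0 nat)"
  scol :: "nat \<Rightarrow> nat \<Rightarrow> nat \<Rightarrow> 'k"
  saug :: "nat \<Rightarrow> 'k"

text \<open>The vector \<open>v\<close> stands for the element with components \<open>v k\<close>
  times the monomial of exponent \<open>a - ssh C i k\<close>. In these coordinates multiplication
  by a monomial is the inclusion \<open>homog_mono\<close>, and one scalar map \<open>bd\<close>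
  serves all degrees.\<close>

definition homog :: "('v, 'k::field) scalar_complex \<Rightarrow> nat \<Rightarrow> ('v \<Rightarrow>\<^sub>0 nat) \<Rightarrow> (nat \<Rightarrow> 'k) set" where
  "homog C i a = {v. \<forall>k. v k \<noteq> 0 \<longrightarrow> k < srk C i \<and> ssh C i k \<preceq> a}"

definition bd :: "('v, 'k::field) scalar_complex \<Rightarrow> nat \<Rightarrow> (nat \<Rightarrow> 'k) \<Rightarrow> nat \<Rightarrow> 'k" where
  "bd C i = lin (srk C (Suc i)) (scol C i)"

definition augs :: "('v, 'k::field) scalar_complex \<Rightarrow> (nat \<Rightarrow> 'k) \<Rightarrow> 'k" where
  "augs C v = (\<Sum>k<srk C 0. v k * saug C k)"

text \<open>In position 0 this is the kernel of the map to the quotient ring, whose part in degree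
  \<open>a\<close> is zero for \<open>a \<in> U\<close>; hence the disjunction.\<close>

definition cyc :: "('v \<Rightarrow>\<^sub>0 nat) set \<Rightarrow> ('v, 'k::field) scalar_complex \<Rightarrow> nat \<Rightarrow>
    ('v \<Rightarrow>\<^sub>0 nat) \<Rightarrow> (nat \<Rightarrow> 'k) set" where
  "cyc U C i a = {v \<in> homog C i a.
     case i of 0 \<Rightarrow> a \<in> U \<or> augs C v = 0 | Suc j \<Rightarrow> bd C j v = (\<lambda>_. 0)}"

definition sres :: "'v set \<Rightarrow> ('v \<Rightarrow>\<^sub>0 nat) set \<Rightarrow> ('v, 'k::field) scalar_complex \<Rightarrow> bool" where
  "sres V U C \<longleftrightarrow>
     (\<forall>t\<in>U. \<forall>u. t \<preceq> u \<longrightarrow> u \<in> U) \<and>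
     (\<forall>i. \<forall>k<srk C i. ssh C i k \<in> multidegrees V) \<and>
     (\<forall>i. \<forall>k<srk C (Suc i). scol C i k \<in> homog C i (ssh C (Suc i) k)) \<and>
     (\<forall>a\<in>multidegrees V. a \<notin> U \<longrightarrow> (\<exists>v\<in>homog C 0 a. augs C v = 1)) \<and>
     (\<forall>i. \<forall>a\<in>multidegrees V. cyc U C i a = bd C i ` homog C (Suc i) a)"

text \<open>A scalar between equal shifts is multiplied by the monomial 1, so this forbids unit
  entries.\<close>

definition smin :: "('v, 'k::field) scalar_complex \<Rightarrow> bool" where
  "smin C \<longleftrightarrow>
     (\<forall>i. \<forall>k<srk C (Suc i). \<forall>j. scol C i k j \<noteq> 0 \<longrightarrow> ssh C i j \<noteq> ssh C (Suc i) k)"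

definition scount :: "('v, 'k::field) scalar_complex \<Rightarrow> nat \<Rightarrow> ('v \<Rightarrow>\<^sub>0 nat) \<Rightarrow> nat" where
  "scount C i a = card {k. k < srk C i \<and> ssh C i k = a}"

lemma sres_up: "sres V U C \<Longrightarrow> t \<in> U \<Longrightarrow> t \<preceq> u \<Longrightarrow> u \<in> U"
  unfolding sres_def by (elim conjE, drule bspec, assumption, drule spec, erule mp)

lemma sres_ssh: "sres V U C \<Longrightarrow> k < srk C i \<Longrightarrow> ssh C i k \<in> multidegrees V"
  by (simp add: sres_def)

lemma sres_scol: "sres V U C \<Longrightarrow> k < srk C (Suc i) \<Longrightarrow> scol C i k \<in> homog C i (ssh C (Suc i) k)"
  by (simp add: sres_def)

lemma sres_surj:
  "sres V U C \<Longrightarrow> a \<in> multidegrees V \<Longrightarrow> a \<notin> U \<Longrightarrow> \<exists>v\<in>homog C 0 a. augs C v = 1"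
  by (simp add: sres_def)

lemma sres_exact:
  "sres V U C \<Longrightarrow> a \<in> multidegrees V \<Longrightarrow> cyc U C i a = bd C i ` homog C (Suc i) a"
  by (simp add: sres_def)

lemma homog_zero [simp]: "(\<lambda>_. 0) \<in> homog C i a"
  by (simp add: homog_def)

lemma homog_add: "u \<in> homog C i a \<Longrightarrow> v \<in> homog C i a \<Longrightarrow> (\<lambda>j. u j + v j) \<in> homog C i a"
  unfolding homog_def by (auto, (metis add.right_neutral add_cancel_right_left)+)

lemma homog_scale: "v \<in> homog C i a \<Longrightarrow> (\<lambda>j. c * v j) \<in> homog C i a"
  by (simp add: homog_def)

lemma homog_uminus: "v \<in> homog C i a \<Longrightarrow> (\<lambda>j. - v j) \<in> homog C i a"
  by (simp add: homog_def)

lemma homog_diff: "u \<in> homog C i a \<Longrightarrow> v \<in> homog C i a \<Longrightarrow> (\<lambda>j. u j - v j) \<in> homog C i a"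
  using homog_add[of u C i a "\<lambda>j. - v j"] homog_uminus[of v C i a] by simp

lemma homog_mono: "v \<in> homog C i a \<Longrightarrow> a \<preceq> b \<Longrightarrow> v \<in> homog C i b"
  unfolding homog_def using mdvd_trans by blast

lemma homog_unit_vec: "k < srk C i \<Longrightarrow> ssh C i k \<preceq> a \<Longrightarrow> unit_vec k \<in> homog C i a"
  by (simp add: homog_def unit_vec_def)

lemma lin_homog:
  assumes W: "\<And>k. k < srk C i \<Longrightarrow> W k \<in> homog C' i' (ssh C i k + f)"
    and v: "v \<in> homog C i a"
  shows "lin (srk C i) W v \<in> homog C' i' (a + f)"
proof -
  have "j < srk C' i' \<and> ssh C' i' j \<preceq> a + f" if "lin (srk C i) W v j \<noteq> 0" for j
  proof -
    from that have "(\<Sum>k<srk C i. v k * W k j) \<noteq> 0"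
      by (simp add: lin_def)
    then obtain k where k: "k < srk C i" "v k * W k j \<noteq> 0"
      by (rule sum.not_neutral_contains_not_neutral) simp
    then have "ssh C i k + f \<preceq> a + f"
      using v by (intro mdvd_add_mono) (auto simp: homog_def)
    moreover have "W k \<in> homog C' i' (ssh C i k + f)"
      using W k by blast
    ultimately have "W k \<in> homog C' i' (a + f)"
      using homog_mono by blast
    then show ?thesis
      using k by (auto simp: homog_def)
  qed
  then show ?thesis
    by (simp add: homog_def)
qed

lemma bd_homog:
  assumes "sres V U C" "v \<in> homog C (Suc i) a"
  shows "bd C i v \<in> homog C i a"
  using lin_homog[of C "Suc i" "scol C i" C i 0 v a] sres_scol[OF assms(1)] assms(2)
  by (simp add: bd_def)

lemma augs_lin: "augs C (lin n W v) = (\<Sum>k<n. v k * augs C (W k))"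
proof -
  have "augs C (lin n W v) = (\<Sum>j<srk C 0. \<Sum>k<n. v k * W k j * saug C j)"
    by (simp add: augs_def lin_def sum_distrib_right)
  also have "\<dots> = (\<Sum>k<n. \<Sum>j<srk C 0. v k * W k j * saug C j)"
    by (rule sum.swap)
  finally show ?thesis
    by (simp add: augs_def sum_distrib_left mult.assoc)
qed

lemma augs_diff: "augs C (\<lambda>j. u j - v j) = augs C u - augs C v"
  by (simp add: augs_def left_diff_distrib sum_subtractf)

lemma augs_scale: "augs C (\<lambda>j. c * v j) = c * augs C v"
  by (simp add: augs_def sum_distrib_left mult.assoc)

lemma augs_unit_vec: "k < srk C 0 \<Longrightarrow> augs C (unit_vec k) = saug C k"
  by (simp add: augs_def unit_vec_def if_distrib[where f = "\<lambda>x. x * _"] cong: if_cong)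

lemma cyc_homog: "v \<in> cyc U C i a \<Longrightarrow> v \<in> homog C i a"
  by (simp add: cyc_def)

lemma bd_in_cyc:
  assumes "sres V U C" "a \<in> multidegrees V" "v \<in> homog C (Suc i) a"
  shows "bd C i v \<in> cyc U C i a"
  using sres_exact[OF assms(1,2)] assms(3) by blast

lemma scol_in_cyc:
  assumes "sres V U C" "k < srk C (Suc i)"
  shows "scol C i k \<in> cyc U C i (ssh C (Suc i) k)"
  using bd_in_cyc[OF assms(1) sres_ssh[OF assms] homog_unit_vec[OF assms(2) mdvd_refl]] assms(2)
  by (simp add: bd_def lin_unit_vec)

lemma bd_bd:
  assumes "sres V U C" "a \<in> multidegrees V" "v \<in> homog C (Suc (Suc i)) a"
  shows "bd C i (bd C (Suc i) v) = (\<lambda>_. 0)"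
  using bd_in_cyc[OF assms] by (simp add: cyc_def)

subsection \<open>Comparison of resolutions\<close>

text \<open>A map of degree \<open>f\<close> lifting multiplication by the monomial \<open>f\<close>
  between the quotient rings. Where the target degree lies in \<open>U\<close> the quotient is zero
  and nothing is asked of the augmentation.\<close>

definition chain_map :: "('v \<Rightarrow>\<^sub>0 nat) set \<Rightarrow> ('v \<Rightarrow>\<^sub>0 nat) \<Rightarrow> ('v, 'k::field) scalar_complex \<Rightarrow>
    ('v, 'k) scalar_complex \<Rightarrow> (nat \<Rightarrow> nat \<Rightarrow> nat \<Rightarrow> 'k) \<Rightarrow> bool" where
  "chain_map U f D C \<phi> \<longleftrightarrow>
     (\<forall>i. \<forall>k<srk D i. \<phi> i k \<in> homog C i (ssh D i k + f)) \<and>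
     (\<forall>k<srk D 0. ssh D 0 k + f \<in> U \<or> augs C (\<phi> 0 k) = saug D k) \<and>
     (\<forall>i. \<forall>k<srk D (Suc i). bd C i (\<phi> (Suc i) k) = lin (srk D i) (\<phi> i) (scol D i k))"

lemma chain_map_homog:
  "chain_map U f D C \<phi> \<Longrightarrow> k < srk D i \<Longrightarrow> \<phi> i k \<in> homog C i (ssh D i k + f)"
  by (simp add: chain_map_def)

lemma chain_map_augs:
  "chain_map U f D C \<phi> \<Longrightarrow> k < srk D 0 \<Longrightarrow> ssh D 0 k + f \<in> U \<or> augs C (\<phi> 0 k) = saug D k"
  by (simp add: chain_map_def)

lemma chain_map_bd:
  "chain_map U f D C \<phi> \<Longrightarrow> k < srk D (Suc i) \<Longrightarrow>
    bd C i (\<phi> (Suc i) k) = lin (srk D i) (\<phi> i) (scol D i k)"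
  by (simp add: chain_map_def)

lemma augs_lin_homog:
  assumes up: "\<And>t u. t \<in> U \<Longrightarrow> t \<preceq> u \<Longrightarrow> u \<in> U"
    and W: "\<And>k. k < srk D 0 \<Longrightarrow> ssh D 0 k + f \<in> U \<or> augs C (W k) = saug D k"
    and v: "v \<in> homog D 0 a"
  shows "a + f \<in> U \<or> augs C (lin (srk D 0) W v) = augs D v"
proof (cases "a + f \<in> U")
  case False
  have "v k * augs C (W k) = v k * saug D k" if "k < srk D 0" for k
  proof (cases "v k = 0")
    case nz: False
    then have "ssh D 0 k + f \<preceq> a + f"
      using v by (intro mdvd_add_mono) (auto simp: homog_def)
    then have "ssh D 0 k + f \<notin> U"
      using False up by blast
    then show ?thesis
      using W[OF that] by simp
  qed simp
  then have "(\<Sum>k<srk D 0. v k * augs C (W k)) = (\<Sum>k<srk D 0. v k * saug D k)"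
    by (intro sum.cong) auto
  then show ?thesis
    by (simp add: augs_lin augs_def[of D])
qed simp

text \<open>Lifting through an exact complex, by dependent choice over the positions. The invariant
  \<open>P\<close> says that cycles go to cycles, which is what makes the next lift of each column
  exist; in position 0 this holds because \<open>U'\<close> is the colon set.\<close>

lemma chain_map_exists:
  assumes C: "sres V U C" and D: "sres V U' D"
    and U': "U' = {t. t + f \<in> U}" and f: "f \<in> multidegrees V"
  shows "\<exists>\<phi>. chain_map U f D C \<phi>"
proof -
  define P where "P = (\<lambda>i \<phi>. (\<forall>k<srk D i. \<phi> k \<in> homog C i (ssh D i k + f)) \<and>
      (\<forall>a\<in>multidegrees V. \<forall>v\<in>cyc U' D i a. lin (srk D i) \<phi> v \<in> cyc U C i (a + f)) \<and>
      (i = 0 \<longrightarrow> (\<forall>k<srk D 0. ssh D 0 k + f \<in> U \<or> augs C (\<phi> k) = saug D k)))"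
  define Q where "Q = (\<lambda>i \<phi> \<phi>'. \<forall>k<srk D (Suc i). bd C i (\<phi>' k) = lin (srk D i) \<phi> (scol D i k))"
  have deg: "ssh D i k + f \<in> multidegrees V" if "k < srk D i" for i k
    using sres_ssh[OF D that] f by (rule multidegrees_add)
  have "\<exists>w. w \<in> homog C 0 (ssh D 0 k + f) \<and> (ssh D 0 k + f \<in> U \<or> augs C w = saug D k)"
    if k: "k < srk D 0" for k
  proof (cases "ssh D 0 k + f \<in> U")
    case False
    then obtain v where "v \<in> homog C 0 (ssh D 0 k + f)" "augs C v = 1"
      using sres_surj[OF C deg[OF k]] by blast
    \<comment> \<open>Scaling a preimage of 1 reaches the prescribed augmentation; in degrees of
      \<open>U\<close> the zero vector will do.\<close>
    then show ?thesis
      by (intro exI[of _ "\<lambda>j. saug D k * v j"]) (simp add: homog_scale augs_scale)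
  qed (use homog_zero in blast)
  then obtain \<phi>0 where \<phi>0: "\<And>k. k < srk D 0 \<Longrightarrow> \<phi>0 k \<in> homog C 0 (ssh D 0 k + f)"
    "\<And>k. k < srk D 0 \<Longrightarrow> ssh D 0 k + f \<in> U \<or> augs C (\<phi>0 k) = saug D k"
    by metis
  have "P 0 \<phi>0"
    unfolding P_def
  proof (intro conjI ballI impI allI)
    fix a v
    assume v: "v \<in> cyc U' D 0 a"
    have "lin (srk D 0) \<phi>0 v \<in> homog C 0 (a + f)"
      using \<phi>0(1) cyc_homog[OF v] by (intro lin_homog)
    moreover have "a + f \<in> U \<or> augs C (lin (srk D 0) \<phi>0 v) = augs D v"
      using sres_up[OF C] \<phi>0(2) cyc_homog[OF v] by (rule augs_lin_homog)
    ultimately show "lin (srk D 0) \<phi>0 v \<in> cyc U C 0 (a + f)"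
      using v by (auto simp: cyc_def U')
  qed (use \<phi>0 in blast)+
  moreover have "\<exists>\<phi>'. P (Suc i) \<phi>' \<and> Q i \<phi> \<phi>'" if \<phi>: "P i \<phi>" for i \<phi>
  proof -
    have "\<exists>w. w \<in> homog C (Suc i) (ssh D (Suc i) k + f) \<and>
        bd C i w = lin (srk D i) \<phi> (scol D i k)" if k: "k < srk D (Suc i)" for k
    proof -
      have "lin (srk D i) \<phi> (scol D i k) \<in> cyc U C i (ssh D (Suc i) k + f)"
        using \<phi> scol_in_cyc[OF D k] sres_ssh[OF D k] unfolding P_def by blast
      then show ?thesis
        using sres_exact[OF C deg[OF k]] by (metis (no_types, lifting) imageE)
    qed
    then obtain \<phi>' where \<phi>': "\<And>k. k < srk D (Suc i) \<Longrightarrow> \<phi>' k \<in> homog C (Suc i) (ssh D (Suc i) k + f)"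
      "\<And>k. k < srk D (Suc i) \<Longrightarrow> bd C i (\<phi>' k) = lin (srk D i) \<phi> (scol D i k)"
      by metis
    have "lin (srk D (Suc i)) \<phi>' v \<in> cyc U C (Suc i) (a + f)" if v: "v \<in> cyc U' D (Suc i) a" for a v
    proof -
      have "bd C i (lin (srk D (Suc i)) \<phi>' v) = lin (srk D (Suc i)) (\<lambda>k. bd C i (\<phi>' k)) v"
        by (simp add: bd_def lin_lin)
      also have "\<dots> = lin (srk D (Suc i)) (\<lambda>k. lin (srk D i) \<phi> (scol D i k)) v"
        using \<phi>'(2) by (intro lin_cong) simp
      also have "\<dots> = lin (srk D i) \<phi> (bd D i v)"
        by (simp add: bd_def lin_lin)
      also have "\<dots> = (\<lambda>_. 0)"
        using v by (simp add: cyc_def)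
      finally show ?thesis
        using lin_homog[of D "Suc i" \<phi>' C "Suc i" f v a] \<phi>'(1) v by (simp add: cyc_def)
    qed
    with \<phi>' have "P (Suc i) \<phi>' \<and> Q i \<phi> \<phi>'"
      unfolding P_def Q_def by simp
    then show ?thesis
      by blast
  qed
  ultimately obtain \<phi> where P: "\<And>i. P i (\<phi> i)" and Q: "\<And>i. Q i (\<phi> i) (\<phi> (Suc i))"
    using dependent_nat_choice[of P Q] by blast
  have "chain_map U f D C \<phi>"
    unfolding chain_map_def using P Q unfolding P_def Q_def by blast
  then show ?thesis
    by blast
qed

lemma chain_map_comp:
  assumes C: "sres V U C" and \<phi>: "chain_map U 0 C D \<phi>" and \<psi>: "chain_map U 0 D C \<psi>"
  shows "chain_map U 0 C C (\<lambda>i k. lin (srk D i) (\<psi> i) (\<phi> i k))"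
proof -
  have 1: "lin (srk D i) (\<psi> i) (\<phi> i k) \<in> homog C i (ssh C i k + 0)" if "k < srk C i" for i k
    using chain_map_homog[OF \<psi>] chain_map_homog[OF \<phi> that] by (intro lin_homog) simp_all
  have 2: "ssh C 0 k + 0 \<in> U \<or> augs C (lin (srk D 0) (\<psi> 0) (\<phi> 0 k)) = saug C k"
    if k: "k < srk C 0" for k
  proof -
    have ph: "\<phi> 0 k \<in> homog D 0 (ssh C 0 k)"
      using chain_map_homog[OF \<phi> k] by simp
    have "ssh C 0 k + 0 \<in> U \<or> augs C (lin (srk D 0) (\<psi> 0) (\<phi> 0 k)) = augs D (\<phi> 0 k)"
      using sres_up[OF C] chain_map_augs[OF \<psi>] ph by (rule augs_lin_homog)
    then show ?thesis
      using chain_map_augs[OF \<phi> k] by auto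
  qed
  have 3: "bd C i (lin (srk D (Suc i)) (\<psi> (Suc i)) (\<phi> (Suc i) k)) =
      lin (srk C i) (\<lambda>k. lin (srk D i) (\<psi> i) (\<phi> i k)) (scol C i k)" if k: "k < srk C (Suc i)" for i k
  proof -
    have "bd C i (lin (srk D (Suc i)) (\<psi> (Suc i)) (\<phi> (Suc i) k)) =
        lin (srk D (Suc i)) (\<lambda>l. bd C i (\<psi> (Suc i) l)) (\<phi> (Suc i) k)"
      by (simp add: bd_def lin_lin)
    also have "\<dots> = lin (srk D (Suc i)) (\<lambda>l. lin (srk D i) (\<psi> i) (scol D i l)) (\<phi> (Suc i) k)"
      by (intro lin_cong chain_map_bd[OF \<psi>])
    also have "\<dots> = lin (srk D i) (\<psi> i) (bd D i (\<phi> (Suc i) k))"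
      by (simp add: bd_def lin_lin)
    also have "\<dots> = lin (srk D i) (\<psi> i) (lin (srk C i) (\<phi> i) (scol C i k))"
      by (simp add: chain_map_bd[OF \<phi> k])
    finally show ?thesis
      by (simp add: lin_lin)
  qed
  show ?thesis
    unfolding chain_map_def using 1 2 3 by blast
qed

text \<open>
  A chain map lifting the identity is homotopic to the identity, and by minimality the homotopy
  contributes nothing to the entries between basis elements of equal degree.
\<close>

lemma minimal_chain_map_entry:
  assumes C: "sres V U C" and min: "smin C" and \<alpha>: "chain_map U 0 C C \<alpha>"
    and k: "k < srk C i" and j: "j < srk C i" "ssh C i j = ssh C i k"
  shows "\<alpha> i k j = unit_vec k j"
proof -
  have \<alpha>h: "\<alpha> i k \<in> homog C i (ssh C i k)" if "k < srk C i" for i k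
    using chain_map_homog[OF \<alpha> that] by simp
  \<comment> \<open>Homogeneity squeezes the shift of a contributing column between two equal
    degrees, so it equals them, against minimality.\<close>
  have bdzero: "bd C i w j = 0"
    if w: "w \<in> homog C (Suc i) (ssh C i k)" and jk: "ssh C i j = ssh C i k" for i w j k
  proof -
    have "w l * scol C i l j = 0" if l: "l < srk C (Suc i)" for l
    proof (rule ccontr)
      assume nz: "w l * scol C i l j \<noteq> 0"
      then have "ssh C (Suc i) l \<preceq> ssh C i j" "ssh C i j \<preceq> ssh C (Suc i) l"
        using w jk sres_scol[OF C l] by (auto simp: homog_def)
      then show False
        using mdvd_antisym min l nz unfolding smin_def by (metis mult_zero_right)
    qed
    then show ?thesis
      unfolding bd_def lin_def by (intro sum.neutral) blast
  qed
  \<comment> \<open>On cycles the homotopy relation d h + h d = \<alpha> - 1 loses its second term.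
    This restricted form carries the induction, since the columns of the next differential are
    cycles.\<close>
  have ex: "\<exists>h. (\<forall>k<srk C i. h k \<in> homog C (Suc i) (ssh C i k)) \<and>
      (\<forall>a\<in>multidegrees V. \<forall>v\<in>cyc U C i a. bd C i (lin (srk C i) h v) =
         (\<lambda>j. lin (srk C i) (\<alpha> i) v j - v j)) \<and>
      (\<forall>k<srk C i. \<forall>j<srk C i. ssh C i j = ssh C i k \<longrightarrow> \<alpha> i k j = unit_vec k j)" for i
  proof (induction i)
    case 0
    have "\<exists>w. w \<in> homog C (Suc 0) (ssh C 0 k) \<and> bd C 0 w = (\<lambda>j. \<alpha> 0 k j - unit_vec k j)"
      if k: "k < srk C 0" for k
    proof -
      have "(\<lambda>j. \<alpha> 0 k j - unit_vec k j) \<in> cyc U C 0 (ssh C 0 k)"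
        using \<alpha>h[OF k] chain_map_augs[OF \<alpha> k] k
        by (auto simp: cyc_def augs_diff augs_unit_vec intro!: homog_diff homog_unit_vec)
      then show ?thesis
        using sres_exact[OF C sres_ssh[OF C k]] by (metis (no_types, lifting) imageE)
    qed
    then obtain h where h: "\<And>k. k < srk C 0 \<Longrightarrow> h k \<in> homog C (Suc 0) (ssh C 0 k)"
      "\<And>k. k < srk C 0 \<Longrightarrow> bd C 0 (h k) = (\<lambda>j. \<alpha> 0 k j - unit_vec k j)"
      by metis
    have "bd C 0 (lin (srk C 0) h v) = (\<lambda>j. lin (srk C 0) (\<alpha> 0) v j - v j)"
      if v: "v \<in> cyc U C 0 a" for v a
    proof -
      have "bd C 0 (lin (srk C 0) h v) = lin (srk C 0) (\<lambda>k. bd C 0 (h k)) v"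
        by (simp add: bd_def lin_lin)
      also have "\<dots> = lin (srk C 0) (\<lambda>k j. \<alpha> 0 k j - unit_vec k j) v"
        using h(2) by (intro lin_cong) simp
      also have "\<dots> = (\<lambda>j. lin (srk C 0) (\<alpha> 0) v j - v j)"
        using cyc_homog[OF v] by (simp add: lin_cols_diff lin_unit_cols homog_def)
      finally show ?thesis .
    qed
    moreover have "\<alpha> 0 k j = unit_vec k j"
      if "k < srk C 0" "j < srk C 0" "ssh C 0 j = ssh C 0 k" for k j
      using bdzero[OF h(1)[OF that(1)] that(3)] h(2)[OF that(1)] by simp
    ultimately show ?case
      using h(1) by blast
  next
    case (Suc i)
    then obtain h where h: "\<And>k. k < srk C i \<Longrightarrow> h k \<in> homog C (Suc i) (ssh C i k)"
      and hc: "\<And>a v. a \<in> multidegrees V \<Longrightarrow> v \<in> cyc U C i a \<Longrightarrow>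
        bd C i (lin (srk C i) h v) = (\<lambda>j. lin (srk C i) (\<alpha> i) v j - v j)"
      by blast
    \<comment> \<open>This is \<alpha> - 1 - h d on basis elements, a cycle; the next homotopy is a
      lift of it.\<close>
    define z where "z = (\<lambda>k j. \<alpha> (Suc i) k j - unit_vec k j - lin (srk C i) h (scol C i k) j)"
    have hs: "lin (srk C i) h (scol C i k) \<in> homog C (Suc i) (ssh C (Suc i) k)"
      if k: "k < srk C (Suc i)" for k
      using lin_homog[of C i h C "Suc i" 0 "scol C i k" "ssh C (Suc i) k"] h sres_scol[OF C k] by simp
    have "\<exists>w. w \<in> homog C (Suc (Suc i)) (ssh C (Suc i) k) \<and> bd C (Suc i) w = z k"
      if k: "k < srk C (Suc i)" for k
    proof -
      have zh: "z k \<in> homog C (Suc i) (ssh C (Suc i) k)"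
        unfolding z_def using k by (intro homog_diff \<alpha>h homog_unit_vec hs mdvd_refl)
      have "bd C i (z k) = (\<lambda>j. bd C i (\<alpha> (Suc i) k) j - bd C i (unit_vec k) j -
          bd C i (lin (srk C i) h (scol C i k)) j)"
        by (simp add: z_def bd_def lin_diff)
      also have "\<dots> = (\<lambda>_. 0)"
        using hc[OF sres_ssh[OF C k] scol_in_cyc[OF C k]] chain_map_bd[OF \<alpha> k] k
        by (simp add: bd_def lin_unit_vec)
      finally have "z k \<in> cyc U C (Suc i) (ssh C (Suc i) k)"
        using zh by (simp add: cyc_def)
      then show ?thesis
        using sres_exact[OF C sres_ssh[OF C k]] by (metis (no_types, lifting) imageE)
    qed
    then obtain h' where h': "\<And>k. k < srk C (Suc i) \<Longrightarrow> h' k \<in> homog C (Suc (Suc i)) (ssh C (Suc i) k)"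
      "\<And>k. k < srk C (Suc i) \<Longrightarrow> bd C (Suc i) (h' k) = z k"
      by metis
    have "bd C (Suc i) (lin (srk C (Suc i)) h' v) = (\<lambda>j. lin (srk C (Suc i)) (\<alpha> (Suc i)) v j - v j)"
      if v: "v \<in> cyc U C (Suc i) a" for v a
    proof -
      have "bd C (Suc i) (lin (srk C (Suc i)) h' v) = lin (srk C (Suc i)) (\<lambda>k. bd C (Suc i) (h' k)) v"
        by (simp add: bd_def lin_lin)
      also have "\<dots> = lin (srk C (Suc i)) z v"
        using h'(2) by (intro lin_cong) simp
      also have "\<dots> = (\<lambda>j. lin (srk C (Suc i)) (\<alpha> (Suc i)) v j - v j - lin (srk C i) h (bd C i v) j)"
        unfolding z_def bd_def lin_cols_diff lin_lin
        using cyc_homog[OF v] by (simp add: lin_unit_cols homog_def)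
      also have "\<dots> = (\<lambda>j. lin (srk C (Suc i)) (\<alpha> (Suc i)) v j - v j)"
        using v by (simp add: cyc_def)
      finally show ?thesis .
    qed
    moreover have "\<alpha> (Suc i) k j = unit_vec k j"
      if k: "k < srk C (Suc i)" and j: "j < srk C (Suc i)" "ssh C (Suc i) j = ssh C (Suc i) k" for k j
    proof -
      have "z k j = 0"
        using bdzero[OF h'(1)[OF k] j(2)] h'(2)[OF k] by simp
      \<comment> \<open>Nor does h d have entries between equal degrees: one would require a nonzero
        entry of the differential between equal shifts.\<close>
      moreover have "scol C i k l * h l j = 0" if l: "l < srk C i" for l
      proof (rule ccontr)
        assume nz: "scol C i k l * h l j \<noteq> 0"
        then have "ssh C i l \<preceq> ssh C (Suc i) k" "ssh C (Suc i) k \<preceq> ssh C i l"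
          using h[OF l] sres_scol[OF C k] j by (auto simp: homog_def)
        then show False
          using mdvd_antisym min k nz unfolding smin_def by (metis mult_zero_left)
      qed
      then have "lin (srk C i) h (scol C i k) j = 0"
        unfolding lin_def by (intro sum.neutral) blast
      ultimately show ?thesis
        by (simp add: z_def)
    qed
    ultimately show ?case
      using h'(1) by blast
  qed
  show ?thesis
    using ex[of i] k j by blast
qed

text \<open>Comparison maps in both directions compose to a self-map of the minimal complex
  \<open>C\<close>, whose block between basis elements of degree \<open>a\<close> is the identity.
  That block factors through the basis elements of degree \<open>a\<close> in
  \<open>D\<close>.\<close>

lemma scount_le:
  fixes C D :: "('v, 'k::field) scalar_complex"
  assumes C: "sres V U C" and min: "smin C" and D: "sres V U D"
  shows "scount C i a \<le> scount D i a"
proof -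
  obtain \<phi> \<psi> where \<phi>: "chain_map U 0 C D \<phi>" and \<psi>: "chain_map U 0 D C \<psi>"
    using chain_map_exists[OF D C, of 0] chain_map_exists[OF C D, of 0] by auto
  define A where "A = {k. k < srk C i \<and> ssh C i k = a}"
  define B where "B = {k. k < srk D i \<and> ssh D i k = a}"
  have "card A \<le> card B"
  proof (rule card_le_of_left_inverse[where P = "\<phi> i" and Q = "\<psi> i"])
    fix k j
    assume k: "k \<in> A" and j: "j \<in> A"
    have "l \<in> B" if l: "l < srk D i" "\<phi> i k l * \<psi> i l j \<noteq> 0" for l
    proof -
      have "\<phi> i k \<in> homog D i (ssh C i k + 0)" "\<psi> i l \<in> homog C i (ssh D i l + 0)"
        using chain_map_homog[OF \<phi>] chain_map_homog[OF \<psi>] k l(1) unfolding A_def by blast+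
      then have "ssh D i l \<preceq> a" "a \<preceq> ssh D i l"
        using k j l by (auto simp: A_def homog_def)
      then show ?thesis
        using l mdvd_antisym by (auto simp: B_def)
    qed
    then have "(\<Sum>l\<in>B. \<phi> i k l * \<psi> i l j) = (\<Sum>l<srk D i. \<phi> i k l * \<psi> i l j)"
      by (intro sum.mono_neutral_left) (auto simp: B_def)
    also have "\<dots> = unit_vec k j"
      using minimal_chain_map_entry[OF C min chain_map_comp[OF C \<phi> \<psi>], of k i j] k j
      by (simp add: A_def lin_def)
    finally show "(\<Sum>l\<in>B. \<phi> i k l * \<psi> i l j) = (if j = k then 1 else 0)"
      by (simp add: unit_vec_def)
  qed (auto simp: A_def B_def)
  then show ?thesis
    by (simp add: scount_def A_def B_def)
qed

subsection \<open>Mapping cones\<close>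

definition cat :: "nat \<Rightarrow> (nat \<Rightarrow> 'k::field) \<Rightarrow> (nat \<Rightarrow> 'k) \<Rightarrow> nat \<Rightarrow> 'k" where
  "cat r u w = (\<lambda>j. if j < r then u j else w (j - r))"

lemma sum_lessThan_add:
  fixes g :: "nat \<Rightarrow> 'a::comm_monoid_add"
  shows "(\<Sum>k<r + s. g k) = (\<Sum>k<r. g k) + (\<Sum>k<s. g (r + k))"
  by (induction s) (simp_all add: add.assoc)

lemma lin_cat:
  "lin (r + s) (\<lambda>k. if k < r then W k else X (k - r)) (cat r u w) = (\<lambda>j. lin r W u j + lin s X w j)"
  by (simp add: lin_def cat_def sum_lessThan_add)

lemma lin_cat_cols: "lin n (\<lambda>k. cat r (W k) (X k)) v = cat r (lin n W v) (lin n X v)"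
  by (auto simp: lin_def cat_def)

text \<open>The degree \<open>a\<close> part of \<open>D\<close> shifted by \<open>f\<close>. It
  differs from \<open>homog D i (a - f)\<close> when \<open>f\<close> does not divide
  \<open>a\<close>: the truncated difference is still a degree, but the shifted module is zero
  there.\<close>

definition twist :: "('v \<Rightarrow>\<^sub>0 nat) \<Rightarrow> ('v, 'k::field) scalar_complex \<Rightarrow> nat \<Rightarrow>
    ('v \<Rightarrow>\<^sub>0 nat) \<Rightarrow> (nat \<Rightarrow> 'k) set" where
  "twist f D i a = {w. \<forall>k. w k \<noteq> 0 \<longrightarrow> k < srk D i \<and> ssh D i k + f \<preceq> a}"

lemma twist_iff: "w \<in> twist f D i a \<longleftrightarrow> w \<in> homog D i (a - f) \<and> (f \<preceq> a \<or> w = (\<lambda>_. 0))"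
  by (auto simp: twist_def homog_def add_mdvd_iff)

lemma lin_twist:
  assumes "\<And>k. k < srk D i \<Longrightarrow> W k \<in> homog C j (ssh D i k + f)" "w \<in> twist f D i a"
  shows "lin (srk D i) W w \<in> homog C j a"
proof (cases "f \<preceq> a")
  case True
  then show ?thesis
    using lin_homog[OF assms(1), of w "a - f"] assms(2) by (simp add: twist_iff mdvd_diff_add)
qed (use assms(2) in \<open>simp add: twist_iff\<close>)

text \<open>
  In position \<open>i\<close> the first \<open>srk C i\<close> basis elements are those of \<open>C\<close>, the others are those of \<open>D\<close> in
  position \<open>i - 1\<close>; the differential is \<open>(u, w) \<mapsto> (d u + \<phi> w, - d w)\<close>.
\<close>

definition cone :: "('v \<Rightarrow>\<^sub>0 nat) \<Rightarrow> (nat \<Rightarrow> nat \<Rightarrow> nat \<Rightarrow> 'k) \<Rightarrow> ('v, 'k::field) scalar_complex \<Rightarrow>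
    ('v, 'k) scalar_complex \<Rightarrow> ('v, 'k) scalar_complex" where
  "cone f \<phi> D C = \<lparr>
     srk = (\<lambda>i. srk C i + (case i of 0 \<Rightarrow> 0 | Suc j \<Rightarrow> srk D j)),
     ssh = (\<lambda>i k. if k < srk C i then ssh C i k else ssh D (i - 1) (k - srk C i) + f),
     scol = (\<lambda>i k. if k < srk C (Suc i) then cat (srk C i) (scol C i k) (\<lambda>_. 0)
        else cat (srk C i) (\<phi> i (k - srk C (Suc i)))
          (case i of 0 \<Rightarrow> \<lambda>_. 0 | Suc j \<Rightarrow> \<lambda>l. - scol D j (k - srk C (Suc i)) l)),
     saug = saug C\<rparr>"

lemma srk_cone [simp]:
  "srk (cone f \<phi> D C) 0 = srk C 0" "srk (cone f \<phi> D C) (Suc i) = srk C (Suc i) + srk D i"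
  by (simp_all add: cone_def)

lemma augs_cone [simp]: "augs (cone f \<phi> D C) = augs C"
  by (rule ext) (simp add: augs_def cone_def)

lemma homog_cone_0 [simp]: "homog (cone f \<phi> D C) 0 a = homog C 0 a"
  by (auto simp: homog_def cone_def)

lemma cat_in_homog_cone:
  "u \<in> homog C (Suc i) a \<Longrightarrow> w \<in> twist f D i a \<Longrightarrow>
    cat (srk C (Suc i)) u w \<in> homog (cone f \<phi> D C) (Suc i) a"
  by (force simp: homog_def cone_def twist_def cat_def)

lemma homog_cone_cases:
  assumes "v \<in> homog (cone f \<phi> D C) (Suc i) a"
  obtains u w where "u \<in> homog C (Suc i) a" "w \<in> twist f D i a" "v = cat (srk C (Suc i)) u w"
proof
  define r where "r = srk C (Suc i)"
  have v: "k < r + srk D i \<and> (if k < r then ssh C (Suc i) k else ssh D i (k - r) + f) \<preceq> a"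
    if "v k \<noteq> 0" for k
    using assms that by (auto simp: homog_def cone_def r_def)
  show "(\<lambda>j. if j < srk C (Suc i) then v j else 0) \<in> homog C (Suc i) a"
    using v unfolding homog_def r_def by (auto, metis)
  show "(\<lambda>j. v (srk C (Suc i) + j)) \<in> twist f D i a"
    using v by (fastforce simp: twist_def r_def)
  show "v = cat (srk C (Suc i)) (\<lambda>j. if j < srk C (Suc i) then v j else 0) (\<lambda>j. v (srk C (Suc i) + j))"
    by (auto simp: cat_def)
qed

lemma cat_zero: "u \<in> homog C i a \<Longrightarrow> cat (srk C i) u (\<lambda>_. 0) = u"
  unfolding cat_def homog_def by (rule ext) auto

lemma cat_eq_zero:
  assumes "cat (srk C i) u w = (\<lambda>_. 0)" "u \<in> homog C i a"
  shows "u = (\<lambda>_. 0)" "w = (\<lambda>_. 0)"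
proof -
  show "u = (\<lambda>_. 0)"
    using assms by (auto simp: cat_def homog_def fun_eq_iff) metis
  show "w = (\<lambda>_. 0)"
  proof
    fix j
    show "w j = 0"
      using fun_cong[OF assms(1), of "srk C i + j"] by (simp add: cat_def)
  qed
qed

lemma bd_cone:
  fixes C :: "('v, 'k::field) scalar_complex"
  shows "bd (cone f \<phi> D C) i (cat (srk C (Suc i)) u w) =
    cat (srk C i) (\<lambda>j. bd C i u j + lin (srk D i) (\<phi> i) w j)
      (case i of 0 \<Rightarrow> \<lambda>_. 0 | Suc l \<Rightarrow> \<lambda>j. - bd D l w j)"
proof -
  define X where
    "X = (\<lambda>m. cat (srk C i) (\<phi> i m) (case i of 0 \<Rightarrow> \<lambda>_. 0 | Suc j \<Rightarrow> \<lambda>l. - scol D j m l))"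
  have 1: "scol (cone f \<phi> D C) i = (\<lambda>k. if k < srk C (Suc i)
      then cat (srk C i) (scol C i k) (\<lambda>_. 0) else X (k - srk C (Suc i)))"
    unfolding X_def by (simp add: cone_def)
  have 2: "lin n (\<lambda>k _. 0) v = (\<lambda>_. 0)" for n and v :: "nat \<Rightarrow> 'k"
    by (simp add: lin_def)
  have 3: "lin n (\<lambda>k l. - W k l) v = (\<lambda>j. - lin n W v j)" for n W and v :: "nat \<Rightarrow> 'k"
    by (simp add: lin_def sum_negf)
  show ?thesis
    unfolding bd_def srk_cone 1
      lin_cat[of _ _ "\<lambda>k. cat (srk C i) (scol C i k) (\<lambda>_. 0)" X]
    unfolding X_def lin_cat_cols
    by (cases i) (auto simp: cat_def 2 3)
qed

text \<open>The long exact sequence of 0 -> (R/(I : f))(-f) -> R/I -> R/(I + (f)) -> 0, carried out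
  on elements in one degree \<open>a\<close>. If \<open>f\<close> does not divide \<open>a\<close>,
  the twisted summand is zero and only \<open>C\<close> remains.\<close>

lemma sres_cone:
  assumes C: "sres V U C" and D: "sres V {t. t + f \<in> U} D" and f: "f \<in> multidegrees V"
    and \<phi>: "chain_map U f D C \<phi>"
  shows "sres V (U \<union> {t. f \<preceq> t}) (cone f \<phi> D C)" (is "sres V ?U ?E")
proof -
  have \<Phi>: "lin (srk D i) (\<phi> i) w \<in> homog C i a" if "w \<in> twist f D i a" for i w a
    using chain_map_homog[OF \<phi>] that by (rule lin_twist)
  have \<Phi>bd: "bd C i (lin (srk D (Suc i)) (\<phi> (Suc i)) w) = lin (srk D i) (\<phi> i) (bd D i w)" for i w
  proof -
    have "bd C i (lin (srk D (Suc i)) (\<phi> (Suc i)) w) = lin (srk D (Suc i)) (\<lambda>l. bd C i (\<phi> (Suc i) l)) w"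
      by (simp add: bd_def lin_lin)
    also have "\<dots> = lin (srk D (Suc i)) (\<lambda>l. lin (srk D i) (\<phi> i) (scol D i l)) w"
      by (intro lin_cong chain_map_bd[OF \<phi>])
    finally show ?thesis
      by (simp add: bd_def lin_lin)
  qed
  have bd_tw: "bd D i w \<in> twist f D i a" if "w \<in> twist f D (Suc i) a" for i w a
    using that bd_homog[OF D, of w i "a - f"] by (auto simp: twist_iff bd_def)
  have neg_tw: "(\<lambda>j. - w j) \<in> twist f D i a" if "w \<in> twist f D i a" for i w a
    using that by (simp add: twist_def)
  have first: "(\<lambda>j. bd C i u j + lin (srk D i) (\<phi> i) w j) \<in> homog C i a"
    if "u \<in> homog C (Suc i) a" "w \<in> twist f D i a" for i u w a
    using bd_homog[OF C that(1)] \<Phi>[OF that(2)] by (rule homog_add)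
  have bdE: "bd ?E i v \<in> homog ?E i a" if "v \<in> homog ?E (Suc i) a" for i v a
    using that
  proof (rule homog_cone_cases)
    fix u w assume uw: "u \<in> homog C (Suc i) a" "w \<in> twist f D i a" "v = cat (srk C (Suc i)) u w"
    show ?thesis
    proof (cases i)
      case 0
      then show ?thesis
        using first[OF uw(1,2)] by (simp add: uw(3) bd_cone cat_zero)
    next
      case (Suc l)
      then show ?thesis
        using first[OF uw(1,2)] uw(2) bd_tw neg_tw
        by (simp add: uw(3) bd_cone cat_in_homog_cone)
    qed
  qed
  have 1: "t \<in> ?U \<Longrightarrow> t \<preceq> u \<Longrightarrow> u \<in> ?U" for t u
    using sres_up[OF C] mdvd_trans by blast
  have 2: "ssh ?E i k \<in> multidegrees V" if "k < srk ?E i" for i k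
    using that sres_ssh[OF C] sres_ssh[OF D] f
    by (cases i) (auto simp: cone_def intro!: multidegrees_add)
  have 3: "scol ?E i k \<in> homog ?E i (ssh ?E (Suc i) k)" if "k < srk ?E (Suc i)" for i k
    using bdE[OF homog_unit_vec[OF that mdvd_refl]] that by (simp add: bd_def lin_unit_vec)
  have 4: "\<exists>v\<in>homog ?E 0 a. augs ?E v = 1" if "a \<in> multidegrees V" "a \<notin> ?U" for a
    using sres_surj[OF C that(1)] that(2) by simp
  have 5: "cyc ?U ?E i a = bd ?E i ` homog ?E (Suc i) a" if a: "a \<in> multidegrees V" for i a
  proof (intro equalityI subsetI)
    fix v assume "v \<in> bd ?E i ` homog ?E (Suc i) a"
    then obtain x where x: "x \<in> homog ?E (Suc i) a" and v: "v = bd ?E i x"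
      by blast
    from x obtain u w where uw: "u \<in> homog C (Suc i) a" "w \<in> twist f D i a"
      and xeq: "x = cat (srk C (Suc i)) u w"
      by (rule homog_cone_cases)
    show "v \<in> cyc ?U ?E i a"
    proof (cases i)
      case 0
      have v': "v = (\<lambda>j. bd C 0 u j + lin (srk D 0) (\<phi> 0) w j)"
        using first[OF uw] by (simp add: v xeq bd_cone cat_zero 0)
      show ?thesis
      proof (cases "f \<preceq> a")
        case True
        then show ?thesis
          using first[OF uw] by (simp add: cyc_def v' 0)
      next
        case False
        then have "v = bd C 0 u"
          using uw(2) by (simp add: v' twist_iff)
        then show ?thesis
          using bd_in_cyc[OF C a uw(1)] 0 by (auto simp: cyc_def)
      qed
    next
      case (Suc l)
      have "bd C l (\<lambda>j. bd C i u j + lin (srk D i) (\<phi> i) w j) =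
          (\<lambda>j. bd C l (bd C i u) j + bd C l (lin (srk D i) (\<phi> i) w) j)"
        by (simp add: bd_def lin_add)
      also have "\<dots> = lin (srk D l) (\<phi> l) (bd D l w)"
        using bd_bd[OF C a, of u l] uw(1) by (simp add: \<Phi>bd Suc)
      finally have *: "bd C l (\<lambda>j. bd C i u j + lin (srk D i) (\<phi> i) w j) = lin (srk D l) (\<phi> l) (bd D l w)" .
      have **: "bd D m (\<lambda>j. - bd D l w j) = (\<lambda>_. 0)" if "l = Suc m" for m
      proof -
        have "bd D m (bd D l w) = (\<lambda>_. 0)"
          using bd_bd[OF D multidegrees_diff[OF a], of w m f] uw(2) that Suc
          by (simp add: twist_iff)
        then show ?thesis
          by (simp add: bd_def lin_uminus)
      qed
      have "v = cat (srk C (Suc l)) (\<lambda>j. bd C i u j + lin (srk D i) (\<phi> i) w j) (\<lambda>j. - bd D l w j)"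
        by (simp add: v xeq bd_cone Suc)
      then have "bd ?E l v = cat (srk C l) (\<lambda>j. bd C l (\<lambda>j. bd C i u j + lin (srk D i) (\<phi> i) w j) j +
          lin (srk D l) (\<phi> l) (\<lambda>j. - bd D l w j) j)
          (case l of 0 \<Rightarrow> \<lambda>_. 0 | Suc m \<Rightarrow> \<lambda>j. - bd D m (\<lambda>j. - bd D l w j) j)"
        by (simp add: bd_cone)
      also have "\<dots> = (\<lambda>_. 0)"
        unfolding * lin_uminus using ** by (auto simp: cat_def split: nat.split)
      finally show ?thesis
        using bdE[OF x] by (simp add: cyc_def Suc v)
    qed
  next
    fix v assume v: "v \<in> cyc ?U ?E i a"
    show "v \<in> bd ?E i ` homog ?E (Suc i) a"
    proof (cases i)
      case 0
      have vh: "v \<in> homog C 0 a"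
        using cyc_homog[OF v] 0 by simp
      have "\<exists>u\<in>homog C 1 a. \<exists>w\<in>twist f D 0 a. v = (\<lambda>j. bd C 0 u j + lin (srk D 0) (\<phi> 0) w j)"
      proof (cases "a \<in> U \<or> augs C v = 0")
        case True
        then have "v \<in> cyc U C 0 a"
          using vh by (simp add: cyc_def)
        then obtain u where "u \<in> homog C 1 a" "v = bd C 0 u"
          using sres_exact[OF C a] by auto
        then show ?thesis
          by (intro bexI[of _ u] bexI[of _ "\<lambda>_. 0"]) (simp_all add: twist_def)
      next
        case False
        then have fa: "f \<preceq> a" "a \<notin> U"
          using v 0 by (auto simp: cyc_def)
        \<comment> \<open>Here \<open>a\<close> lies in the new ideal only because of
          \<open>f\<close>. Subtracting \<phi> of a scaled \<open>w\<close> cancels the augmentation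
          of \<open>v\<close> and leaves a cycle of \<open>C\<close>.\<close>
        then obtain w where w: "w \<in> homog D 0 (a - f)" "augs D w = 1"
          using sres_surj[OF D multidegrees_diff[OF a], of f] by (auto simp: mdvd_diff_add)
        define w' where "w' = (\<lambda>j. augs C v * w j)"
        have w': "w' \<in> homog D 0 (a - f)" "augs D w' = augs C v"
          using w by (simp_all add: w'_def homog_scale augs_scale)
        have tw: "w' \<in> twist f D 0 a"
          using w' fa by (simp add: twist_iff)
        have "a - f + f \<in> U \<or> augs C (lin (srk D 0) (\<phi> 0) w') = augs D w'"
          using sres_up[OF C] chain_map_augs[OF \<phi>] w'(1) by (rule augs_lin_homog)
        then have "(\<lambda>j. v j - lin (srk D 0) (\<phi> 0) w' j) \<in> cyc U C 0 a"
          using vh \<Phi>[OF tw] fa w' by (simp add: cyc_def augs_diff homog_diff mdvd_diff_add)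
        then obtain u where "u \<in> homog C 1 a" "(\<lambda>j. v j - lin (srk D 0) (\<phi> 0) w' j) = bd C 0 u"
          using sres_exact[OF C a] by auto
        then show ?thesis
          using tw by (intro bexI[of _ u] bexI[of _ w']) (auto simp: fun_eq_iff algebra_simps)
      qed
      then obtain u w where uw: "u \<in> homog C 1 a" "w \<in> twist f D 0 a"
        "v = (\<lambda>j. bd C 0 u j + lin (srk D 0) (\<phi> 0) w j)"
        by blast
      then have "v = bd ?E 0 (cat (srk C 1) u w)"
        using vh by (simp add: bd_cone cat_zero)
      then show ?thesis
        using uw cat_in_homog_cone[of u C 0 a w f D \<phi>] 0 by auto
    next
      case (Suc l)
      have "v \<in> homog ?E (Suc l) a"
        using cyc_homog[OF v] Suc by simp
      then obtain u w where uw: "u \<in> homog C i a" "w \<in> twist f D l a"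
        and veq: "v = cat (srk C i) u w"
        unfolding Suc by (rule homog_cone_cases)
      have "bd ?E l v = (\<lambda>_. 0)"
        using v by (simp add: cyc_def Suc)
      then have z: "cat (srk C l) (\<lambda>j. bd C l u j + lin (srk D l) (\<phi> l) w j)
          (case l of 0 \<Rightarrow> \<lambda>_. 0 | Suc m \<Rightarrow> \<lambda>j. - bd D m w j) = (\<lambda>_. 0)"
        by (simp add: veq Suc bd_cone)
      have z1: "(\<lambda>j. bd C l u j + lin (srk D l) (\<phi> l) w j) = (\<lambda>_. 0)"
        and z2: "(case l of 0 \<Rightarrow> \<lambda>_. 0 | Suc m \<Rightarrow> \<lambda>j. - bd D m w j) = (\<lambda>_. 0)"
        using cat_eq_zero[OF z first] uw Suc by auto
      \<comment> \<open>The second component of a cycle is a boundary of \<open>D\<close>; the sign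
        is that of the differential of the cone.\<close>
      have "\<exists>w'\<in>twist f D i a. w = (\<lambda>j. - bd D l w' j)"
      proof (cases "f \<preceq> a")
        case True
        have wh: "w \<in> homog D l (a - f)"
          using uw(2) by (simp add: twist_iff)
        have "w \<in> cyc {t. t + f \<in> U} D l (a - f)"
        proof (cases l)
          case 0
          \<comment> \<open>In the lowest position of \<open>D\<close>, being a cycle is a condition
            on the augmentation. It holds because \<phi> \<open>w\<close> = - d \<open>u\<close> is
            a boundary of \<open>C\<close>.\<close>
          have "a \<in> U \<or> augs D w = 0"
          proof (cases "a \<in> U")
            case False
            have "a - f + f \<in> U \<or> augs C (lin (srk D 0) (\<phi> 0) w) = augs D w"
              using sres_up[OF C] chain_map_augs[OF \<phi>] wh[unfolded 0] by (rule augs_lin_homog)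
            then have "augs D w = augs C (lin (srk D 0) (\<phi> 0) w)"
              using False True by (simp add: mdvd_diff_add)
            also have "lin (srk D 0) (\<phi> 0) w = (\<lambda>j. - bd C 0 u j)"
              using z1 unfolding 0 by (simp add: fun_eq_iff add_eq_0_iff)
            also have "augs C \<dots> = - augs C (bd C 0 u)"
              by (simp add: augs_def sum_negf)
            also have "\<dots> = 0"
              using bd_in_cyc[OF C a, of u 0] uw(1) False by (simp add: cyc_def Suc 0)
            finally show ?thesis ..
          qed simp
          then show ?thesis
            using wh True 0 by (simp add: cyc_def mdvd_diff_add)
        next
          case (Suc m)
          then show ?thesis
            using wh z2 by (simp add: cyc_def fun_eq_iff)
        qed
        then obtain x where x: "x \<in> homog D (Suc l) (a - f)" "w = bd D l x"
          using sres_exact[OF D multidegrees_diff[OF a]] by auto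
        then show ?thesis
          using True Suc
          by (intro bexI[of _ "\<lambda>j. - x j"]) (simp_all add: bd_def lin_uminus twist_iff homog_uminus)
      next
        case False
        then have "w = (\<lambda>_. 0)"
          using uw(2) by (simp add: twist_iff)
        then show ?thesis
          by (intro bexI[of _ "\<lambda>_. 0"]) (simp_all add: bd_def twist_def)
      qed
      then obtain w' where w': "w' \<in> twist f D i a" "w = (\<lambda>j. - bd D l w' j)"
        by blast
      \<comment> \<open>Removing \<phi> of \<open>w'\<close> from \<open>u\<close> leaves a cycle of
        \<open>C\<close>, whose preimage is the first component sought.\<close>
      define y where "y = (\<lambda>j. u j - lin (srk D i) (\<phi> i) w' j)"
      have yh: "y \<in> homog C i a"
        unfolding y_def using uw(1) \<Phi>[OF w'(1)] by (rule homog_diff)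
      have "bd C l y = (\<lambda>j. bd C l u j - lin (srk D l) (\<phi> l) (bd D l w') j)"
        using \<Phi>bd[of l w'] by (simp add: y_def bd_def lin_diff Suc)
      also have "\<dots> = (\<lambda>j. bd C l u j + lin (srk D l) (\<phi> l) w j)"
        by (simp add: w'(2) lin_uminus)
      finally have "y \<in> cyc U C i a"
        using yh z1 Suc by (simp add: cyc_def)
      then obtain u' where u': "u' \<in> homog C (Suc i) a" "y = bd C i u'"
        using sres_exact[OF C a] by auto
      have "u = (\<lambda>j. bd C i u' j + lin (srk D i) (\<phi> i) w' j)"
        using u'(2) by (auto simp: y_def fun_eq_iff algebra_simps)
      then have "v = bd ?E i (cat (srk C (Suc i)) u' w')"
        using w'(2) veq by (simp add: bd_cone Suc)
      then show ?thesis
        using cat_in_homog_cone[OF u'(1) w'(1)] by blast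
    qed
  qed
  show ?thesis
    unfolding sres_def using 1 2 3 4 5 by blast
qed

subsection \<open>Betti numbers of monomial ideals\<close>

text \<open>Keeping only the counting function of some minimal resolution lets the later inductions
  work with numbers. The type token fixes the field, which neither \<open>U\<close> nor
  \<open>B\<close> mentions.\<close>

definition has_betti :: "'k::field itself \<Rightarrow> 'v set \<Rightarrow> ('v \<Rightarrow>\<^sub>0 nat) set \<Rightarrow>
    (nat \<Rightarrow> ('v \<Rightarrow>\<^sub>0 nat) \<Rightarrow> nat) \<Rightarrow> bool" where
  "has_betti K V U B \<longleftrightarrow>
     (\<exists>C :: ('v, 'k) scalar_complex. sres V U C \<and> smin C \<and> (\<forall>i a. scount C i a = B i a))"

text \<open>The guards counter truncated subtraction: otherwise position 0 and degrees not divisible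
  by \<open>f\<close> would pick up spurious terms.\<close>

definition cone_betti :: "('v \<Rightarrow>\<^sub>0 nat) \<Rightarrow> (nat \<Rightarrow> ('v \<Rightarrow>\<^sub>0 nat) \<Rightarrow> nat) \<Rightarrow>
    (nat \<Rightarrow> ('v \<Rightarrow>\<^sub>0 nat) \<Rightarrow> nat) \<Rightarrow> nat \<Rightarrow> ('v \<Rightarrow>\<^sub>0 nat) \<Rightarrow> nat" where
  "cone_betti f B B' i a = B i a + (if i > 0 \<and> f \<preceq> a then B' (i - 1) (a - f) else 0)"

lemma cone_betti_nonzero:
  assumes "cone_betti f B B' i a \<noteq> 0"
  shows "B i a \<noteq> 0 \<or> (\<exists>j b. i = Suc j \<and> a = b + f \<and> B' j b \<noteq> 0)"
proof (cases "B i a = 0")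
  case True
  then have "i > 0" "f \<preceq> a" "B' (i - 1) (a - f) \<noteq> 0"
    using assms by (auto simp: cone_betti_def split: if_splits)
  then show ?thesis
    by (intro disjI2 exI[of _ "i - 1"] exI[of _ "a - f"]) (simp add: mdvd_diff_add)
qed simp

lemma scount_cone: "scount (cone f \<phi> D C) i a = cone_betti f (scount C) (scount D) i a"
proof (cases i)
  case 0
  show ?thesis
    by (simp add: scount_def cone_betti_def cone_def 0 cong: conj_cong)
next
  case (Suc l)
  let ?A = "{k. k < srk C i \<and> ssh C i k = a}"
  let ?B = "{k. k < srk D l \<and> ssh D l k + f = a}"
  have "{k. k < srk (cone f \<phi> D C) i \<and> ssh (cone f \<phi> D C) i k = a} = ?A \<union> (\<lambda>k. srk C i + k) ` ?B"
  proof (intro set_eqI)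
    fix k
    show "k \<in> {k. k < srk (cone f \<phi> D C) i \<and> ssh (cone f \<phi> D C) i k = a} \<longleftrightarrow>
        k \<in> ?A \<union> (\<lambda>k. srk C i + k) ` ?B"
    proof (cases "k < srk C i")
      case False
      then obtain m where "k = srk C i + m"
        using le_Suc_ex not_less by blast
      then show ?thesis
        by (auto simp: cone_def Suc)
    qed (auto simp: cone_def)
  qed
  moreover have "card (?A \<union> (\<lambda>k. srk C i + k) ` ?B) = card ?A + card ((\<lambda>k. srk C i + k) ` ?B)"
    by (rule card_Un_disjoint) auto
  moreover have "card ((\<lambda>k. srk C i + k) ` ?B) = card ?B"
    by (rule card_image) simp
  moreover have "?B = (if f \<preceq> a then {k. k < srk D l \<and> ssh D l k = a - f} else {})"
    by (auto simp: mdvd_diff_add)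
  ultimately show ?thesis
    by (simp add: scount_def cone_betti_def Suc)
qed

text \<open>The blocks of \<open>C\<close> and \<open>D\<close> inherit minimality. A unit could
  only occur in the block of \<phi>, between basis elements of equal degree in the same position of
  \<open>C\<close> and of the twisted \<open>D\<close>; the last assumption excludes such
  pairs.\<close>

lemma has_betti_cone:
  fixes K :: "'k::field itself" and V :: "'v set"
  assumes C: "has_betti K V U B" and D: "has_betti K V {t. t + f \<in> U} B'"
    and f: "f \<in> multidegrees V" and disj: "\<And>i a. B i (a + f) = 0 \<or> B' i a = 0"
  shows "has_betti K V (U \<union> {t. f \<preceq> t}) (cone_betti f B B')"
proof -
  obtain C :: "('v, 'k) scalar_complex"
    where C: "sres V U C" "smin C" "\<And>i a. scount C i a = B i a"
    using C unfolding has_betti_def by blast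
  obtain D :: "('v, 'k) scalar_complex"
    where D: "sres V {t. t + f \<in> U} D" "smin D" "\<And>i a. scount D i a = B' i a"
    using D unfolding has_betti_def by blast
  obtain \<phi> where \<phi>: "chain_map U f D C \<phi>"
    using chain_map_exists[OF C(1) D(1) refl f] by blast
  have sh: "ssh C i j \<noteq> ssh D i k + f" if "j < srk C i" "k < srk D i" for i j k
  proof
    assume eq: "ssh C i j = ssh D i k + f"
    have "scount C i (ssh D i k + f) \<noteq> 0" "scount D i (ssh D i k) \<noteq> 0"
      using that eq by (auto simp: scount_def)
    then show False
      using disj[of i "ssh D i k"] C(3) D(3) by simp
  qed
  have "smin (cone f \<phi> D C)"
    unfolding smin_def
  proof (intro allI impI)
    fix i k j
    assume k: "k < srk (cone f \<phi> D C) (Suc i)" and nz: "scol (cone f \<phi> D C) i k j \<noteq> 0"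
    show "ssh (cone f \<phi> D C) i j \<noteq> ssh (cone f \<phi> D C) (Suc i) k"
    proof (cases "k < srk C (Suc i)")
      case True
      then have "j < srk C i" "scol C i k j \<noteq> 0"
        using nz by (auto simp: cone_def cat_def split: if_splits)
      then show ?thesis
        using True C(2) by (auto simp: smin_def cone_def)
    next
      case False
      define m where "m = k - srk C (Suc i)"
      have m: "m < srk D i"
        using k False by (auto simp: m_def)
      show ?thesis
      proof (cases "j < srk C i")
        case True
        then show ?thesis
          using sh[OF True m] False by (simp add: cone_def m_def)
      next
        case j: False
        then obtain l where l: "i = Suc l" "scol D l m (j - srk C i) \<noteq> 0"
          using nz False by (cases i) (auto simp: cone_def cat_def m_def)
        then have "ssh D l (j - srk C i) \<noteq> ssh D (Suc l) m"
          using D(2) m unfolding smin_def by blast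
        then show ?thesis
          using False j l by (simp add: cone_def m_def)
      qed
    qed
  qed
  moreover have "scount (cone f \<phi> D C) i a = cone_betti f B B' i a" for i a
    using C(3) D(3) by (simp add: scount_cone cone_betti_def)
  ultimately show ?thesis
    using sres_cone[OF C(1) D(1) f \<phi>] unfolding has_betti_def by blast
qed

lemma has_betti_zero_ideal:
  fixes K :: "'k::field itself" and V :: "'v set"
  shows "has_betti K V {} (\<lambda>i a. if i = 0 \<and> a = 0 then 1 else 0)"
proof -
  define C :: "('v, 'k) scalar_complex" where
    "C = \<lparr>srk = (\<lambda>i. if i = 0 then 1 else 0), ssh = (\<lambda>_ _. 0), scol = (\<lambda>_ _ _. 0), saug = (\<lambda>_. 1)\<rparr>"
  have srk: "srk C i = (if i = 0 then 1 else 0)" and ssh: "ssh C i k = 0" and aug: "augs C v = v 0" for i k v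
    by (simp_all add: C_def augs_def)
  have h0: "v \<in> homog C 0 a \<longleftrightarrow> (\<forall>k. v k \<noteq> 0 \<longrightarrow> k = 0)" for v a
    by (simp add: homog_def srk ssh)
  have hS: "homog C (Suc i) a = {\<lambda>_. 0}" for i a
    by (auto simp: homog_def srk ssh)
  have bd: "bd C i v = (\<lambda>_. 0)" for i v
    by (simp add: bd_def lin_def srk)
  have "cyc {} C i a = {\<lambda>_. 0}" for i a
  proof (cases i)
    case 0
    then show ?thesis
      unfolding cyc_def using h0 by (auto simp: aug fun_eq_iff)
  qed (auto simp: cyc_def hS bd)
  moreover have "\<exists>v\<in>homog C 0 a. augs C v = 1" for a
    by (intro bexI[of _ "unit_vec 0"]) (auto simp: h0 aug unit_vec_def)
  ultimately have "sres V {} C"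
    by (simp add: sres_def srk ssh hS bd)
  moreover have "smin C"
    by (simp add: smin_def srk)
  moreover have "scount C i a = (if i = 0 \<and> a = 0 then 1 else 0)" for i a
    by (auto simp: scount_def srk ssh)
  ultimately show ?thesis
    unfolding has_betti_def by blast
qed

subsection \<open>Monomial ideals\<close>

definition mono_ideal :: "'v set \<Rightarrow> ('v \<Rightarrow>\<^sub>0 nat) set \<Rightarrow> ('v, 'k::field) poly_over set" where
  "mono_ideal V U = {p \<in> polys V. Poly_Mapping.keys p \<subseteq> U}"

lemma polys_iff: "p \<in> polys V \<longleftrightarrow> (\<forall>t. Poly_Mapping.lookup p t \<noteq> 0 \<longrightarrow> t \<in> multidegrees V)"
  by (auto simp: polys_def in_keys_iff)

lemma mono_ideal_iff:
  "p \<in> mono_ideal V U \<longleftrightarrow> p \<in> polys V \<and> (\<forall>t. Poly_Mapping.lookup p t \<noteq> 0 \<longrightarrow> t \<in> U)"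
  by (auto simp: mono_ideal_def in_keys_iff)

lemma lookup_single_mult:
  "Poly_Mapping.lookup (Poly_Mapping.single t c * p) u =
    (if t \<preceq> u then c * Poly_Mapping.lookup p (u - t) else (0::'k::field))"
proof -
  have "Poly_Mapping.lookup (Poly_Mapping.single t c * p) u =
      c * (\<Sum>q. Poly_Mapping.lookup p q when u = t + q)"
    by (simp add: lookup_mult lookup_single when_mult)
  also have "(\<lambda>q. Poly_Mapping.lookup p q when u = t + q) =
      (\<lambda>q. if t \<preceq> u then Poly_Mapping.lookup p q when q = u - t else 0)"
    by (rule ext) (auto simp: when_def mdvd_diff_add add.commute[of t])
  finally show ?thesis
    by simp
qed

lemma polys_zero [simp]: "0 \<in> polys V"
  by (simp add: polys_iff)

lemma polys_single: "t \<in> multidegrees V \<Longrightarrow> Poly_Mapping.single t c \<in> polys V"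
  by (simp add: polys_iff lookup_single)

lemma polys_add: "p \<in> polys V \<Longrightarrow> q \<in> polys V \<Longrightarrow> p + q \<in> polys V"
  unfolding polys_iff lookup_add by (metis add.right_neutral)

lemma polys_diff: "p \<in> polys V \<Longrightarrow> q \<in> polys V \<Longrightarrow> p - q \<in> polys V"
  unfolding polys_iff lookup_minus by (metis diff_zero)

lemma polys_mult: "p \<in> polys V \<Longrightarrow> q \<in> polys V \<Longrightarrow> p * q \<in> polys V"
  unfolding polys_def using keys_mult[of p q] multidegrees_add by blast

lemma polys_sum: "(\<And>x. x \<in> A \<Longrightarrow> p x \<in> polys V) \<Longrightarrow> sum p A \<in> polys V"
  by (induction A rule: infinite_finite_induct) (auto intro: polys_add)

lemma is_ideal_mono_ideal:
  assumes up: "\<And>t u. t \<in> U \<Longrightarrow> t \<preceq> u \<Longrightarrow> u \<in> U"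
  shows "is_ideal V (mono_ideal V U)"
proof -
  have "Poly_Mapping.keys (f + g) \<subseteq> U"
    if "Poly_Mapping.keys f \<subseteq> U" "Poly_Mapping.keys g \<subseteq> U" for f g :: "('a, 'b) poly_over"
    using that keys_add[of f g] by blast
  moreover have "Poly_Mapping.keys (r * f) \<subseteq> U"
    if "Poly_Mapping.keys f \<subseteq> U" for r f :: "('a, 'b) poly_over"
  proof
    fix t assume "t \<in> Poly_Mapping.keys (r * f)"
    then obtain x y where "t = x + y" "y \<in> Poly_Mapping.keys f"
      using keys_mult[of r f] by blast
    then show "t \<in> U"
      using that up[of y t] by auto
  qed
  ultimately show ?thesis
    unfolding is_ideal_def mono_ideal_def by (auto intro: polys_add polys_mult)
qed

lemma ideal_gen_zero: "0 \<in> ideal_gen V S"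
  and ideal_gen_add: "f \<in> ideal_gen V S \<Longrightarrow> g \<in> ideal_gen V S \<Longrightarrow> f + g \<in> ideal_gen V S"
  and ideal_gen_mult: "r \<in> polys V \<Longrightarrow> f \<in> ideal_gen V S \<Longrightarrow> r * f \<in> ideal_gen V S"
  by (auto simp: ideal_gen_def hull_def is_ideal_def)

lemma ideal_gen_monomials:
  fixes M :: "('v \<Rightarrow>\<^sub>0 nat) set"
  assumes M: "M \<subseteq> multidegrees V"
  shows "ideal_gen V ((\<lambda>m. Poly_Mapping.single m 1) ` M) =
    (mono_ideal V {t. \<exists>m\<in>M. m \<preceq> t} :: ('v, 'k::field) poly_over set)"
proof
  let ?S = "(\<lambda>m. Poly_Mapping.single m 1) ` M :: ('v, 'k) poly_over set"
  let ?U = "{t. \<exists>m\<in>M. m \<preceq> t}"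
  have "is_ideal V (mono_ideal V ?U :: ('v, 'k) poly_over set)"
    by (rule is_ideal_mono_ideal) (use mdvd_trans in blast)
  moreover have "?S \<subseteq> mono_ideal V ?U"
    using M by (auto simp: mono_ideal_def intro!: polys_single intro: mdvd_refl)
  ultimately show "ideal_gen V ?S \<subseteq> mono_ideal V ?U"
    unfolding ideal_gen_def by (intro hull_minimal)
  show "mono_ideal V ?U \<subseteq> ideal_gen V ?S"
  proof
    fix p :: "('v, 'k) poly_over"
    assume p: "p \<in> mono_ideal V ?U"
    have "(\<Sum>t\<in>A. Poly_Mapping.single t (Poly_Mapping.lookup p t)) \<in> ideal_gen V ?S"
      if "finite A" "A \<subseteq> Poly_Mapping.keys p" for A
      using that
    proof (induction A rule: finite_induct)
      case (insert t A)
      obtain m where m: "m \<in> M" "m \<preceq> t" "t \<in> multidegrees V"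
        using p insert.prems unfolding mono_ideal_def polys_def by blast
      have "Poly_Mapping.single (t - m) (Poly_Mapping.lookup p t) * Poly_Mapping.single m 1 \<in> ideal_gen V ?S"
        using m by (intro ideal_gen_mult polys_single multidegrees_diff)
          (auto simp: ideal_gen_def intro: hull_inc)
      moreover have "Poly_Mapping.single (t - m) (Poly_Mapping.lookup p t) * Poly_Mapping.single m 1 =
          Poly_Mapping.single t (Poly_Mapping.lookup p t)"
        using m by (simp add: mult_single mdvd_diff_add)
      ultimately have "Poly_Mapping.single t (Poly_Mapping.lookup p t) \<in> ideal_gen V ?S"
        by simp
      then show ?case
        using insert by (simp add: ideal_gen_add)
    qed (simp add: ideal_gen_zero)
    from this[of "Poly_Mapping.keys p"]
    have "(\<Sum>t\<in>Poly_Mapping.keys p. Poly_Mapping.single t (Poly_Mapping.lookup p t)) \<in> ideal_gen V ?S"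
      by simp
    also have "(\<Sum>t\<in>Poly_Mapping.keys p. Poly_Mapping.single t (Poly_Mapping.lookup p t)) = p"
      by (rule poly_mapping_eqI) (auto simp: lookup_sum lookup_single when_def in_keys_iff)
    finally show "p \<in> ideal_gen V ?S" .
  qed
qed

lemma single_mdvd_iff: "Poly_Mapping.single v (1::nat) \<preceq> t \<longleftrightarrow> v \<in> Poly_Mapping.keys t"
  by (auto simp: mdvd_def lookup_single when_def in_keys_iff)

lemma single_in_multidegrees [simp]: "Poly_Mapping.single v (1::nat) \<in> multidegrees V \<longleftrightarrow> v \<in> V"
  by (simp add: multidegrees_def)

text \<open>Turns minimality into the absence of constant terms, the form in which it meets
  \<open>smin\<close>.\<close>

lemma max_ideal_eq:
  "max_ideal V = (mono_ideal V {t. t \<noteq> 0} :: ('v, 'k::field) poly_over set)"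
proof -
  let ?M = "(\<lambda>v. Poly_Mapping.single v (1::nat)) ` V"
  have "var ` V = ((\<lambda>m. Poly_Mapping.single m 1) ` ?M :: ('v, 'k) poly_over set)"
    by (simp add: image_image var_def)
  moreover have "?M \<subseteq> multidegrees V"
    by (auto simp: multidegrees_def)
  ultimately have "max_ideal V = (mono_ideal V {t. \<exists>m\<in>?M. m \<preceq> t} :: ('v, 'k) poly_over set)"
    unfolding max_ideal_def by (simp only: ideal_gen_monomials)
  also have "\<dots> = mono_ideal V {t. \<exists>v\<in>V. v \<in> Poly_Mapping.keys t}"
    unfolding bex_simps single_mdvd_iff ..
  also have "\<dots> = mono_ideal V {t. t \<noteq> 0}"
  proof -
    have "(\<exists>v\<in>V. v \<in> Poly_Mapping.keys t) \<longleftrightarrow> t \<noteq> 0" if "t \<in> multidegrees V" for t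
      using that by (auto simp: multidegrees_def) (metis Poly_Mapping.keys_eq_empty ex_in_conv subsetD)
    then show ?thesis
      unfolding mono_ideal_def polys_def by blast
  qed
  finally show ?thesis .
qed

subsection \<open>From scalar complexes to free resolutions\<close>

text \<open>A relation and not a function of \<open>C\<close>, because the entries of
  \<open>F\<close> beyond the ranks are arbitrary.\<close>

definition presents :: "('v, 'k::field) free_complex \<Rightarrow> ('v, 'k) scalar_complex \<Rightarrow> bool" where
  "presents F C \<longleftrightarrow> rk F = srk C \<and> shift F = ssh C \<and>
     (\<forall>i. \<forall>j<srk C i. \<forall>k<srk C (Suc i).
        dmat F i j k = Poly_Mapping.single (ssh C (Suc i) k - ssh C i j) (scol C i k j)) \<and>
     (\<forall>k<srk C 0. aug F k = Poly_Mapping.single (ssh C 0 k) (saug C k))"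

text \<open>The part of \<open>sres\<close> that concerns neither the ideal nor exactness; assuming
  only this, \<open>resolves_iff_sres\<close> can be an equivalence.\<close>

definition wf_scalar :: "'v set \<Rightarrow> ('v, 'k::field) scalar_complex \<Rightarrow> bool" where
  "wf_scalar V C \<longleftrightarrow> (\<forall>i. \<forall>k<srk C i. ssh C i k \<in> multidegrees V) \<and>
     (\<forall>i. \<forall>k<srk C (Suc i). scol C i k \<in> homog C i (ssh C (Suc i) k))"

definition deg_part :: "('v, 'k::field) scalar_complex \<Rightarrow> nat \<Rightarrow> ('v \<Rightarrow>\<^sub>0 nat) \<Rightarrow>
    (nat \<Rightarrow> ('v, 'k) poly_over) \<Rightarrow> nat \<Rightarrow> 'k" where
  "deg_part C i a f =
    (\<lambda>k. if k < srk C i \<and> ssh C i k \<preceq> a then Poly_Mapping.lookup (f k) (a - ssh C i k) else 0)"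

lemma deg_part_homog: "deg_part C i a f \<in> homog C i a"
  by (simp add: deg_part_def homog_def)

lemma deg_part_multidegree:
  assumes "wf_scalar V C" "f \<in> free_mod V (srk C i)" "deg_part C i a f \<noteq> (\<lambda>_. 0)"
  shows "a \<in> multidegrees V"
proof -
  obtain k where k: "k < srk C i" "ssh C i k \<preceq> a" "Poly_Mapping.lookup (f k) (a - ssh C i k) \<noteq> 0"
    using assms(3) by (auto simp: deg_part_def fun_eq_iff split: if_splits)
  then have "a - ssh C i k \<in> multidegrees V" "ssh C i k \<in> multidegrees V"
    using assms(1,2) by (auto simp: free_mod_def polys_iff wf_scalar_def)
  then show ?thesis
    using multidegrees_add mdvd_diff_add[OF k(2)] by metis
qed

lemma finite_deg_part: "finite {a. deg_part C i a f \<noteq> (\<lambda>_. 0)}"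
proof (rule finite_subset)
  show "{a. deg_part C i a f \<noteq> (\<lambda>_. 0)} \<subseteq> (\<Union>k<srk C i. (\<lambda>t. t + ssh C i k) ` Poly_Mapping.keys (f k))"
  proof
    fix a assume "a \<in> {a. deg_part C i a f \<noteq> (\<lambda>_. 0)}"
    then obtain k where k: "k < srk C i" "ssh C i k \<preceq> a" "Poly_Mapping.lookup (f k) (a - ssh C i k) \<noteq> 0"
      by (auto simp: deg_part_def fun_eq_iff split: if_splits)
    then have "a \<in> (\<lambda>t. t + ssh C i k) ` Poly_Mapping.keys (f k)"
      by (intro image_eqI[of _ _ "a - ssh C i k"]) (simp_all add: mdvd_diff_add in_keys_iff)
    then show "a \<in> (\<Union>k<srk C i. (\<lambda>t. t + ssh C i k) ` Poly_Mapping.keys (f k))"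
      using k(1) by blast
  qed
qed simp

lemma deg_part_eqI:
  assumes wf: "wf_scalar V C" and f: "f \<in> free_mod V (srk C i)" and g: "g \<in> free_mod V (srk C i)"
    and eq: "\<And>a. a \<in> multidegrees V \<Longrightarrow> deg_part C i a f = deg_part C i a g"
  shows "f = g"
proof
  fix k
  show "f k = g k"
  proof (cases "k < srk C i")
    case True
    have "deg_part C i (t + ssh C i k) f k = deg_part C i (t + ssh C i k) g k" for t
      using eq deg_part_multidegree[OF wf f] deg_part_multidegree[OF wf g] by metis
    then show ?thesis
      using True by (intro poly_mapping_eqI) (simp add: deg_part_def)
  qed (use f g in \<open>simp add: free_mod_def\<close>)
qed

text \<open>An element may be prescribed degree by degree if finitely many degrees occur; this is
  how preimages found separately in each degree are assembled.\<close>

lemma deg_part_surj: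
  assumes wf: "wf_scalar V C" and B: "finite B" "B \<subseteq> multidegrees V"
    and w: "\<And>b. b \<in> B \<Longrightarrow> w b \<in> homog C i b"
  shows "\<exists>f\<in>free_mod V (srk C i). \<forall>a. deg_part C i a f = (if a \<in> B then w a else (\<lambda>_. 0))"
proof
  define f where "f = (\<lambda>k. if k < srk C i then \<Sum>b\<in>B. Poly_Mapping.single (b - ssh C i k) (w b k) else 0)"
  show "f \<in> free_mod V (srk C i)"
    using B by (auto simp: free_mod_def f_def intro!: polys_sum polys_single multidegrees_diff)
  show "\<forall>a. deg_part C i a f = (if a \<in> B then w a else (\<lambda>_. 0))"
  proof (intro allI ext)
    fix a k
    show "deg_part C i a f k = (if a \<in> B then w a else (\<lambda>_. 0)) k"
    proof (cases "k < srk C i \<and> ssh C i k \<preceq> a")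
      case True
      \<comment> \<open>Truncated differences may coincide for distinct degrees. A nonzero
        \<open>w b k\<close> forces the shift to divide \<open>b\<close>, and there subtraction is
        injective.\<close>
      have "(w b k when b - ssh C i k = a - ssh C i k) = (if b = a then w b k else 0)" if "b \<in> B" for b
      proof (cases "w b k = 0")
        case False
        then have "ssh C i k \<preceq> b"
          using w[OF that] by (simp add: homog_def)
        then have "b - ssh C i k = a - ssh C i k \<longleftrightarrow> b = a"
          using True mdvd_diff_add by metis
        then show ?thesis
          by (simp add: when_def)
      qed (auto simp: when_def)
      then have "deg_part C i a f k = (\<Sum>b\<in>B. if b = a then w b k else 0)"
        using True by (simp add: deg_part_def f_def lookup_sum lookup_single)
      then show ?thesis
        using B(1) by simp
    next
      case False
      then have "a \<in> B \<Longrightarrow> w a k = 0"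
        using w[of a] by (auto simp: homog_def)
      with False show ?thesis
        by (auto simp: deg_part_def)
    qed
  qed
qed

lemma diff_map_free_mod:
  assumes F: "presents F C" and wf: "wf_scalar V C" and f: "f \<in> free_mod V (srk C (Suc i))"
  shows "diff_map F i f \<in> free_mod V (srk C i)"
  using F wf f
  by (auto simp: free_mod_def diff_map_def presents_def wf_scalar_def
      intro!: polys_sum polys_mult polys_single multidegrees_diff)

lemma deg_part_diff_map:
  assumes F: "presents F C" and wf: "wf_scalar V C"
  shows "deg_part C i a (diff_map F i f) = bd C i (deg_part C (Suc i) a f)"
proof
  fix j
  have h: "j < srk C i \<and> ssh C i j \<preceq> ssh C (Suc i) k"
    if "k < srk C (Suc i)" "scol C i k j \<noteq> 0" for k
    using wf that by (auto simp: wf_scalar_def homog_def)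
  show "deg_part C i a (diff_map F i f) j = bd C i (deg_part C (Suc i) a f) j"
  proof (cases "j < srk C i \<and> ssh C i j \<preceq> a")
    case True
    have "Poly_Mapping.lookup (dmat F i j k * f k) (a - ssh C i j) = deg_part C (Suc i) a f k * scol C i k j"
      if k: "k < srk C (Suc i)" for k
    proof -
      have "Poly_Mapping.lookup (dmat F i j k * f k) (a - ssh C i j) =
          (if ssh C (Suc i) k - ssh C i j \<preceq> a - ssh C i j then scol C i k j *
            Poly_Mapping.lookup (f k) (a - ssh C i j - (ssh C (Suc i) k - ssh C i j)) else 0)"
        using F True k by (simp add: presents_def lookup_single_mult)
      also have "\<dots> = deg_part C (Suc i) a f k * scol C i k j"
      proof (cases "scol C i k j = 0")
        case False
        then have "ssh C i j \<preceq> ssh C (Suc i) k"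
          using h k by blast
        then show ?thesis
          using True k by (simp add: deg_part_def mdvd_diff_diff)
      qed simp
      finally show ?thesis .
    qed
    then show ?thesis
      using True F by (simp add: deg_part_def[of C i] diff_map_def presents_def lookup_sum bd_def lin_def)
  next
    case False
    have "deg_part C (Suc i) a f k * scol C i k j = 0" if k: "k < srk C (Suc i)" for k
      using False h[OF k] deg_part_homog[of C "Suc i" a f] mdvd_trans unfolding homog_def by fastforce
    then have "bd C i (deg_part C (Suc i) a f) j = 0"
      unfolding bd_def lin_def by (intro sum.neutral) blast
    then show ?thesis
      using False by (auto simp: deg_part_def)
  qed
qed

lemma lookup_aug_map:
  assumes F: "presents F C"
  shows "Poly_Mapping.lookup (aug_map F f) a = augs C (deg_part C 0 a f)"
proof -
  have "Poly_Mapping.lookup (aug_map F f) a =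
      (\<Sum>k<srk C 0. Poly_Mapping.lookup (aug F k * f k) a)"
    using F by (simp add: aug_map_def presents_def lookup_sum)
  also have "\<dots> = (\<Sum>k<srk C 0. deg_part C 0 a f k * saug C k)"
    using F by (intro sum.cong) (auto simp: deg_part_def presents_def lookup_single_mult)
  finally show ?thesis
    by (simp add: augs_def)
qed

lemma aug_map_polys:
  assumes F: "presents F C" and wf: "wf_scalar V C" and f: "f \<in> free_mod V (srk C 0)"
  shows "aug_map F f \<in> polys V"
  using F wf f unfolding aug_map_def presents_def wf_scalar_def free_mod_def
  by (auto intro!: polys_sum polys_mult polys_single)

text \<open>Merges the clause of \<open>resolves_quotient\<close> for position 0 with those for
  higher positions, in parallel with \<open>cyc\<close>.\<close>

definition cycle_mod :: "'v set \<Rightarrow> ('v, 'k::field) poly_over set \<Rightarrow> ('v, 'k) free_complex \<Rightarrow> nat \<Rightarrow>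
    (nat \<Rightarrow> ('v, 'k) poly_over) set" where
  "cycle_mod V I F i = {f \<in> free_mod V (rk F i).
     case i of 0 \<Rightarrow> aug_map F f \<in> I | Suc j \<Rightarrow> diff_map F j f = (\<lambda>_. 0)}"

lemma cycle_mod_iff:
  assumes F: "presents F C" and wf: "wf_scalar V C"
  shows "f \<in> cycle_mod V (mono_ideal V U) F i \<longleftrightarrow> f \<in> free_mod V (srk C i) \<and>
    (\<forall>a\<in>multidegrees V. deg_part C i a f \<in> cyc U C i a)"
proof (cases "f \<in> free_mod V (srk C i)")
  case f: True
  have rk: "rk F = srk C"
    using F by (simp add: presents_def)
  show ?thesis
  proof (cases i)
    case 0
    have "Poly_Mapping.lookup (aug_map F f) a = 0" if "a \<notin> multidegrees V" for a
      using aug_map_polys[OF F wf] f that 0 by (auto simp: polys_iff)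
    then show ?thesis
      using f aug_map_polys[OF F wf, of f] lookup_aug_map[OF F, of f]
      by (auto simp: cycle_mod_def rk 0 mono_ideal_iff cyc_def deg_part_homog)
  next
    case (Suc l)
    have z: "(\<lambda>_. 0) \<in> free_mod V (srk C l)"
      by (simp add: free_mod_def)
    have c0: "deg_part C l a (\<lambda>_. 0) = (\<lambda>_. 0)" for a
      by (simp add: deg_part_def fun_eq_iff)
    have "diff_map F l f = (\<lambda>_. 0) \<longleftrightarrow>
        (\<forall>a\<in>multidegrees V. deg_part C l a (diff_map F l f) = (\<lambda>_. 0))"
      using deg_part_eqI[OF wf diff_map_free_mod[OF F wf] z, of f] f Suc c0 by auto
    then show ?thesis
      using f by (simp add: cycle_mod_def rk Suc cyc_def deg_part_homog deg_part_diff_map[OF F wf])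
  qed
qed (use F in \<open>simp add: cycle_mod_def presents_def\<close>)

lemma zero_cyc: "(\<lambda>_. 0) \<in> cyc U C i a"
  by (simp add: cyc_def augs_def bd_def split: nat.split)

text \<open>From left to right, elements concentrated in the single degree \<open>a\<close> are
  used; from right to left, preimages of the finitely many nonzero degree parts are put
  together.\<close>

lemma exact_iff:
  assumes F: "presents F C" and wf: "wf_scalar V C"
  shows "cycle_mod V (mono_ideal V U) F i = diff_map F i ` free_mod V (rk F (Suc i)) \<longleftrightarrow>
    (\<forall>a\<in>multidegrees V. cyc U C i a = bd C i ` homog C (Suc i) a)"
proof
  have rk: "rk F = srk C"
    using F by (simp add: presents_def)
  note cm = cycle_mod_iff[OF F wf, of _ U i]
  {
    assume ex: "cycle_mod V (mono_ideal V U) F i = diff_map F i ` free_mod V (rk F (Suc i))"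
    show "\<forall>a\<in>multidegrees V. cyc U C i a = bd C i ` homog C (Suc i) a"
    proof (intro ballI equalityI subsetI)
      fix a v assume a: "a \<in> multidegrees V" and v: "v \<in> cyc U C i a"
      obtain f where f: "f \<in> free_mod V (srk C i)"
        "\<And>b. deg_part C i b f = (if b \<in> {a} then v else (\<lambda>_. 0))"
        using deg_part_surj[OF wf, of "{a}" "\<lambda>_. v" i] a cyc_homog[OF v] by auto
      then have "f \<in> cycle_mod V (mono_ideal V U) F i"
        using v by (simp add: cm zero_cyc)
      then obtain g where "f = diff_map F i g"
        unfolding ex by blast
      then have "v = bd C i (deg_part C (Suc i) a g)"
        using f(2)[of a] deg_part_diff_map[OF F wf, of i a g] by simp
      then show "v \<in> bd C i ` homog C (Suc i) a"
        using deg_part_homog by blast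
    next
      fix a v assume a: "a \<in> multidegrees V" and "v \<in> bd C i ` homog C (Suc i) a"
      then obtain u where u: "u \<in> homog C (Suc i) a" "v = bd C i u"
        by blast
      obtain g where g: "g \<in> free_mod V (srk C (Suc i))"
        "\<And>b. deg_part C (Suc i) b g = (if b \<in> {a} then u else (\<lambda>_. 0))"
        using deg_part_surj[OF wf, of "{a}" "\<lambda>_. u" "Suc i"] a u(1) by auto
      then have "diff_map F i g \<in> cycle_mod V (mono_ideal V U) F i"
        unfolding ex rk by blast
      then have "deg_part C i a (diff_map F i g) \<in> cyc U C i a"
        using a by (simp add: cm)
      then show "v \<in> cyc U C i a"
        using g(2)[of a] u(2) by (simp add: deg_part_diff_map[OF F wf])
    qed
  }
  {
    assume ex: "\<forall>a\<in>multidegrees V. cyc U C i a = bd C i ` homog C (Suc i) a"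
    show "cycle_mod V (mono_ideal V U) F i = diff_map F i ` free_mod V (rk F (Suc i))"
    proof (intro equalityI subsetI)
      fix f assume f: "f \<in> cycle_mod V (mono_ideal V U) F i"
      then have fm: "f \<in> free_mod V (srk C i)"
        by (simp add: cm)
      have "\<exists>w. w \<in> homog C (Suc i) a \<and> bd C i w = deg_part C i a f" if a: "a \<in> multidegrees V" for a
      proof -
        have "deg_part C i a f \<in> bd C i ` homog C (Suc i) a"
          using f a ex by (simp add: cm)
        then show ?thesis
          by (metis imageE)
      qed
      then obtain w where w: "\<And>a. a \<in> multidegrees V \<Longrightarrow> w a \<in> homog C (Suc i) a"
        "\<And>a. a \<in> multidegrees V \<Longrightarrow> bd C i (w a) = deg_part C i a f"
        by metis
      define B where "B = {a. deg_part C i a f \<noteq> (\<lambda>_. 0)}"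
      have "B \<subseteq> multidegrees V"
        using deg_part_multidegree[OF wf fm] by (auto simp: B_def)
      then obtain g where g: "g \<in> free_mod V (srk C (Suc i))"
        "\<And>a. deg_part C (Suc i) a g = (if a \<in> B then w a else (\<lambda>_. 0))"
        using deg_part_surj[OF wf, of B w "Suc i"] w(1) finite_deg_part[of C i f] by (auto simp: B_def)
      have "f = diff_map F i g"
      proof (rule deg_part_eqI[OF wf fm diff_map_free_mod[OF F wf g(1)]])
        fix a assume "a \<in> multidegrees V"
        then show "deg_part C i a f = deg_part C i a (diff_map F i g)"
          using w(2) unfolding deg_part_diff_map[OF F wf] g(2) by (auto simp: B_def bd_def)
      qed
      then show "f \<in> diff_map F i ` free_mod V (rk F (Suc i))"
        using g(1) by (simp add: rk)
    next
      fix f assume "f \<in> diff_map F i ` free_mod V (rk F (Suc i))"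
      then obtain g where g: "g \<in> free_mod V (srk C (Suc i))" "f = diff_map F i g"
        by (auto simp: rk)
      then show "f \<in> cycle_mod V (mono_ideal V U) F i"
        using ex diff_map_free_mod[OF F wf g(1)] deg_part_homog[of C "Suc i" _ g]
        by (auto simp: cm deg_part_diff_map[OF F wf])
    qed
  }
qed

lemma resolves_iff_sres:
  fixes F :: "('v, 'k::field) free_complex"
  assumes F: "presents F C" and wf: "wf_scalar V C"
    and up: "\<And>t u. t \<in> U \<Longrightarrow> t \<preceq> u \<Longrightarrow> u \<in> U"
  shows "resolves_quotient V (mono_ideal V U) F \<longleftrightarrow> sres V U C"
proof -
  have rk: "rk F = srk C"
    using F by (simp add: presents_def)
  have surj: "(\<forall>p\<in>polys V. \<exists>f\<in>free_mod V (rk F 0). p - aug_map F f \<in> mono_ideal V U) \<longleftrightarrow>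
      (\<forall>a\<in>multidegrees V. a \<notin> U \<longrightarrow> (\<exists>v\<in>homog C 0 a. augs C v = 1))"
  proof (intro iffI ballI impI)
    fix a
    assume ex: "\<forall>p\<in>polys V. \<exists>f\<in>free_mod V (rk F 0). p - aug_map F f \<in> mono_ideal V U"
      and a: "a \<in> multidegrees V" "a \<notin> U"
    \<comment> \<open>Surjectivity is tested on the monomial of degree \<open>a\<close>; as
      \<open>a \<notin> U\<close>, its coefficient must be hit exactly.\<close>
    have "Poly_Mapping.single a 1 \<in> polys V"
      using a(1) by (rule polys_single)
    then obtain f where "Poly_Mapping.single a 1 - aug_map F f \<in> mono_ideal V U"
      using ex by blast
    then have "augs C (deg_part C 0 a f) = 1"
      using a(2) unfolding mono_ideal_iff lookup_minus lookup_aug_map[OF F]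
      by (metis eq_iff_diff_eq_0 lookup_single_eq)
    then show "\<exists>v\<in>homog C 0 a. augs C v = 1"
      using deg_part_homog by blast
  next
    fix p :: "('v, 'k) poly_over"
    assume ex: "\<forall>a\<in>multidegrees V. a \<notin> U \<longrightarrow> (\<exists>v\<in>homog C 0 a. augs C v = 1)"
      and p: "p \<in> polys V"
    obtain w where w: "\<And>a. a \<in> multidegrees V \<Longrightarrow> a \<notin> U \<Longrightarrow> w a \<in> homog C 0 a"
      "\<And>a. a \<in> multidegrees V \<Longrightarrow> a \<notin> U \<Longrightarrow> augs C (w a) = 1"
      using ex by metis
    \<comment> \<open>Terms in \<open>U\<close> vanish in the quotient, so only the others need a
      preimage.\<close>
    define B where "B = Poly_Mapping.keys p - U"
    have B: "finite B" "B \<subseteq> multidegrees V"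
      using p by (auto simp: B_def polys_def)
    have "(\<lambda>j. Poly_Mapping.lookup p b * w b j) \<in> homog C 0 b" if "b \<in> B" for b
      using w(1)[of b] B(2) that by (intro homog_scale) (auto simp: B_def)
    then obtain f where f: "f \<in> free_mod V (srk C 0)"
      "\<And>a. deg_part C 0 a f = (if a \<in> B then \<lambda>j. Poly_Mapping.lookup p a * w a j else (\<lambda>_. 0))"
      using deg_part_surj[OF wf B, of "\<lambda>a j. Poly_Mapping.lookup p a * w a j" 0] by blast
    have "Poly_Mapping.lookup (p - aug_map F f) a = 0" if "a \<notin> U" for a
    proof (cases "a \<in> B")
      case True
      then show ?thesis
        using w(2)[of a] B that by (auto simp: lookup_minus lookup_aug_map[OF F] f(2) augs_scale)
    next
      case False
      then show ?thesis
        using that by (auto simp: lookup_minus lookup_aug_map[OF F] f(2) B_def augs_def in_keys_iff)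
    qed
    then have "p - aug_map F f \<in> mono_ideal V U"
      using p aug_map_polys[OF F wf f(1)] polys_diff unfolding mono_ideal_iff by blast
    then show "\<exists>f\<in>free_mod V (rk F 0). p - aug_map F f \<in> mono_ideal V U"
      using f(1) by (auto simp: rk)
  qed
  let ?ex = "\<lambda>i. cycle_mod V (mono_ideal V U) F i = diff_map F i ` free_mod V (rk F (Suc i))"
  have "(\<forall>i. ?ex i) \<longleftrightarrow> ?ex 0 \<and> (\<forall>i. ?ex (Suc i))"
    by (metis not0_implies_Suc)
  then have "resolves_quotient V (mono_ideal V U) F \<longleftrightarrow>
      (\<forall>a\<in>multidegrees V. a \<notin> U \<longrightarrow> (\<exists>v\<in>homog C 0 a. augs C v = 1)) \<and> (\<forall>i. ?ex i)"
    unfolding resolves_quotient_def surj by (simp add: cycle_mod_def)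
  also have "\<dots> \<longleftrightarrow> sres V U C"
    unfolding exact_iff[OF F wf] sres_def using wf up unfolding wf_scalar_def by blast
  finally show ?thesis .
qed

text \<open>Provides the existence on which the choice in \<open>betti\<close> rests. A nonzero
  scalar between distinct shifts becomes a nonconstant monomial, so \<open>smin\<close> yields
  entries in the maximal ideal.\<close>

lemma minimal_resolution_of_scalar:
  fixes C :: "('v, 'k::field) scalar_complex"
  assumes C: "sres V U C" and min: "smin C"
  shows "\<exists>F :: ('v, 'k) free_complex. minimal_free_resolution V (mono_ideal V U) F \<and>
    rk F = srk C \<and> shift F = ssh C"
proof -
  define F :: "('v, 'k) free_complex" where "F = \<lparr>rk = srk C, shift = ssh C,
    dmat = (\<lambda>i j k. Poly_Mapping.single (ssh C (Suc i) k - ssh C i j) (scol C i k j)),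
    aug = (\<lambda>k. Poly_Mapping.single (ssh C 0 k) (saug C k))\<rparr>"
  have F: "presents F C"
    by (simp add: presents_def F_def)
  have wf: "wf_scalar V C"
    using sres_ssh[OF C] sres_scol[OF C] by (simp add: wf_scalar_def)
  have "resolves_quotient V (mono_ideal V U) F \<longleftrightarrow> sres V U C"
    using F wf by (rule resolves_iff_sres) (rule sres_up[OF C])
  then have "resolves_quotient V (mono_ideal V U) F"
    using C by simp
  moreover have dv: "ssh C i j \<preceq> ssh C (Suc i) k"
    if "k < srk C (Suc i)" "scol C i k j \<noteq> 0" for i j k
    using sres_scol[OF C that(1)] that(2) by (simp add: homog_def)
  then have "multigraded V F"
    using sres_ssh[OF C]
    by (auto simp: multigraded_def F_def mdvd_diff_add add.commute[of "ssh C _ _"]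
        intro!: polys_single multidegrees_diff split: if_splits)
  moreover have "dmat F i j k \<in> max_ideal V" if "j < rk F i" "k < rk F (Suc i)" for i j k
  proof (cases "scol C i k j = 0")
    case False
    then have "ssh C (Suc i) k - ssh C i j \<noteq> 0"
      using min dv[of k i j] mdvd_diff_add[of "ssh C i j" "ssh C (Suc i) k"] that
      by (fastforce simp: smin_def F_def)
    then show ?thesis
      using that sres_ssh[OF C]
      by (auto simp: max_ideal_eq mono_ideal_def F_def intro!: polys_single multidegrees_diff)
  qed (simp add: F_def max_ideal_eq mono_ideal_def)
  ultimately have "minimal_free_resolution V (mono_ideal V U) F"
    by (simp add: minimal_free_resolution_def)
  moreover have "rk F = srk C" "shift F = ssh C"
    by (simp_all add: F_def)
  ultimately show ?thesis
    by blast
qed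

text \<open>The multigrading leaves room for one monomial in each entry, so an entry is determined
  by its coefficient there.\<close>

lemma scalar_of_minimal_resolution:
  fixes F :: "('v, 'k::field) free_complex"
  assumes F: "minimal_free_resolution V (mono_ideal V U) F"
    and up: "\<And>t u. t \<in> U \<Longrightarrow> t \<preceq> u \<Longrightarrow> u \<in> U"
  shows "\<exists>C :: ('v, 'k) scalar_complex. sres V U C \<and> smin C \<and> srk C = rk F \<and> ssh C = shift F"
proof -
  \<comment> \<open>The value 0 beyond the ranks keeps the support of each column inside the basis,
    as \<open>homog\<close> requires.\<close>
  define C :: "('v, 'k) scalar_complex" where "C = \<lparr>srk = rk F, ssh = shift F,
    scol = (\<lambda>i k j. if j < rk F i \<and> k < rk F (Suc i)
      then Poly_Mapping.lookup (dmat F i j k) (shift F (Suc i) k - shift F i j) else 0),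
    saug = (\<lambda>k. Poly_Mapping.lookup (aug F k) (shift F 0 k))\<rparr>"
  have mg: "multigraded V F" and res: "resolves_quotient V (mono_ideal V U) F"
    and mi: "\<And>i j k. j < rk F i \<Longrightarrow> k < rk F (Suc i) \<Longrightarrow> dmat F i j k \<in> max_ideal V"
    using F by (simp_all add: minimal_free_resolution_def)
  have key: "shift F i j + t = shift F (Suc i) k"
    if "j < rk F i" "k < rk F (Suc i)" "Poly_Mapping.lookup (dmat F i j k) t \<noteq> 0" for i j k t
    using mg that by (simp add: multigraded_def in_keys_iff)
  have dm: "dmat F i j k =
      Poly_Mapping.single (ssh C (Suc i) k - ssh C i j) (scol C i k j)"
    if jk: "j < rk F i" "k < rk F (Suc i)" for i j k
  proof (rule poly_mapping_eqI)
    fix t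
    show "Poly_Mapping.lookup (dmat F i j k) t =
        Poly_Mapping.lookup (Poly_Mapping.single (ssh C (Suc i) k - ssh C i j) (scol C i k j)) t"
    proof (cases "Poly_Mapping.lookup (dmat F i j k) t = 0")
      case True
      then show ?thesis
        using jk by (auto simp: C_def lookup_single when_def)
    next
      case False
      then have "t = shift F (Suc i) k - shift F i j"
        using key[OF jk] by (metis add_diff_cancel_left')
      then show ?thesis
        using jk by (simp add: C_def)
    qed
  qed
  have au: "aug F k = Poly_Mapping.single (ssh C 0 k) (saug C k)" if "k < rk F 0" for k
  proof (rule poly_mapping_eqI)
    fix t
    have "t = shift F 0 k" if "Poly_Mapping.lookup (aug F k) t \<noteq> 0"
      using mg \<open>k < rk F 0\<close> that by (simp add: multigraded_def in_keys_iff)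
    then show "Poly_Mapping.lookup (aug F k) t =
        Poly_Mapping.lookup (Poly_Mapping.single (ssh C 0 k) (saug C k)) t"
      by (auto simp: C_def lookup_single when_def)
  qed
  have P: "presents F C"
    using dm au by (simp add: presents_def) (simp add: C_def)
  have nz: "j < rk F i \<and> shift F i j \<preceq> shift F (Suc i) k \<and> shift F i j \<noteq> shift F (Suc i) k"
    if k: "k < rk F (Suc i)" and "scol C i k j \<noteq> 0" for i j k
  proof -
    have j: "j < rk F i"
      and l: "Poly_Mapping.lookup (dmat F i j k) (shift F (Suc i) k - shift F i j) \<noteq> 0"
      using that by (auto simp: C_def split: if_splits)
    have "shift F i j \<preceq> shift F (Suc i) k"
      using key[OF j k l] by (metis mdvd_add(2))
    moreover have "shift F (Suc i) k - shift F i j \<noteq> 0"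
      using l mi[OF j k] by (auto simp: max_ideal_eq mono_ideal_iff)
    ultimately show ?thesis
      using j by auto
  qed
  have "wf_scalar V C"
    using mg nz by (auto simp: wf_scalar_def multigraded_def homog_def) (auto simp: C_def)
  with P have "resolves_quotient V (mono_ideal V U) F \<longleftrightarrow> sres V U C"
    by (rule resolves_iff_sres) (rule up)
  then have "sres V U C"
    using res by simp
  moreover have "smin C"
    using nz by (simp add: smin_def) (simp add: C_def)
  moreover have "srk C = rk F" "ssh C = shift F"
    by (simp_all add: C_def)
  ultimately show ?thesis
    by blast
qed

text \<open>The complex extracted from the chosen resolution and the one behind \<open>B\<close> are
  both minimal, so \<open>scount_le\<close> applies in both directions.\<close>

lemma betti_eq:
  fixes K :: "'k::field itself"
  assumes "has_betti K V U B"
  shows "betti V (mono_ideal V U :: ('v, 'k) poly_over set) i a = B i a"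
proof -
  obtain C :: "('v, 'k) scalar_complex"
    where C: "sres V U C" "smin C" "\<And>i a. scount C i a = B i a"
    using assms unfolding has_betti_def by blast
  define F where "F = (SOME F. minimal_free_resolution V (mono_ideal V U :: ('v, 'k) poly_over set) F)"
  have "minimal_free_resolution V (mono_ideal V U) F"
    unfolding F_def by (rule someI_ex) (use minimal_resolution_of_scalar[OF C(1,2)] in blast)
  then have "\<exists>D :: ('v, 'k) scalar_complex. sres V U D \<and> smin D \<and> srk D = rk F \<and> ssh D = shift F"
    by (rule scalar_of_minimal_resolution) (rule sres_up[OF C(1)])
  then obtain D :: "('v, 'k) scalar_complex"
    where D: "sres V U D" "smin D" "srk D = rk F" "ssh D = shift F"
    by blast
  have "betti V (mono_ideal V U :: ('v, 'k) poly_over set) i a = scount D i a"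
    by (simp add: betti_def scount_def D F_def[symmetric])
  also have "\<dots> = scount C i a"
    using scount_le[OF C(1,2) D(1)] scount_le[OF D(1,2) C(1)] by (intro antisym)
  finally show ?thesis
    using C(3) by simp
qed

subsection \<open>Resolutions of edge ideals of fans\<close>

definition tdeg :: "('v \<Rightarrow>\<^sub>0 nat) \<Rightarrow> nat" where
  "tdeg a = (\<Sum>v\<in>Poly_Mapping.keys a. Poly_Mapping.lookup a v)"

lemma tdeg_add: "tdeg (a + b) = tdeg a + tdeg b"
  unfolding tdeg_def by (rule setsum_keys_plus_distrib) simp_all

lemma tdeg_single [simp]: "tdeg (Poly_Mapping.single v (Suc 0)) = 1"
  by (simp add: tdeg_def)

lemma tdeg_zero [simp]: "tdeg 0 = 0"
  by (simp add: tdeg_def)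

lemma keys_add_nat: "Poly_Mapping.keys (a + b) = Poly_Mapping.keys a \<union> Poly_Mapping.keys (b :: 'v \<Rightarrow>\<^sub>0 nat)"
  by (auto simp: in_keys_iff lookup_add)

lemma mdvd_keys: "a \<preceq> b \<Longrightarrow> Poly_Mapping.keys a \<subseteq> Poly_Mapping.keys b"
  unfolding mdvd_def subset_iff in_keys_iff by (metis le_0_eq)

definition edge_mon :: "'v \<Rightarrow> 'v \<Rightarrow> ('v \<Rightarrow>\<^sub>0 nat)" where
  "edge_mon u v = Poly_Mapping.single u 1 + Poly_Mapping.single v 1"

lemma keys_edge_mon [simp]: "Poly_Mapping.keys (edge_mon u v) = {u, v}"
  by (auto simp: edge_mon_def keys_add_nat)

lemma edge_mon_mdvd_iff:
  assumes "u \<noteq> v"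
  shows "edge_mon u v \<preceq> t \<longleftrightarrow> u \<in> Poly_Mapping.keys t \<and> v \<in> Poly_Mapping.keys t"
proof
  assume "edge_mon u v \<preceq> t"
  then show "u \<in> Poly_Mapping.keys t \<and> v \<in> Poly_Mapping.keys t"
    using mdvd_keys[of "edge_mon u v" t] by simp
next
  assume "u \<in> Poly_Mapping.keys t \<and> v \<in> Poly_Mapping.keys t"
  then show "edge_mon u v \<preceq> t"
    using assms by (auto simp: mdvd_def edge_mon_def lookup_add lookup_single when_def in_keys_iff)
qed

lemma tdeg_edge_mon [simp]: "tdeg (edge_mon u v) = 2"
  by (simp add: edge_mon_def tdeg_add)

lemma edge_mon_multidegree: "u \<in> V \<Longrightarrow> v \<in> V \<Longrightarrow> edge_mon u v \<in> multidegrees V"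
  by (simp add: multidegrees_def)

text \<open>Used with \<open>n = 1\<close>, where \<open>B\<close> must vanish at multiples of
  \<open>f\<close>, and with \<open>n = 2\<close>.\<close>

lemma cone_betti_le:
  assumes "\<And>i a. B i a \<le> n" "\<And>i a. B' i a \<le> 1" "\<And>i a. f \<preceq> a \<Longrightarrow> B i a \<le> n - 1" "n \<ge> 1"
  shows "cone_betti f B B' i a \<le> n"
  using assms(1)[of i a] assms(2)[of "i - 1" "a - f"] assms(3)[of a i] assms(4)
  by (auto simp: cone_betti_def)

section \<open>Ideals generated by variables\<close>

text \<open>This is the Koszul complex, built one variable at a time: the colon by a new variable is
  the old ideal itself. That degree equals position later makes the bipartite resolution
  linear.\<close>

lemma koszul_betti:
  fixes V :: "'v set"
  assumes "finite S" "S \<subseteq> V"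
  shows "\<exists>B. has_betti K V {t. Poly_Mapping.keys t \<inter> S \<noteq> {}} B \<and> (\<forall>i a. B i a \<le> 1) \<and>
    (\<forall>i a. B i a \<noteq> 0 \<longrightarrow> Poly_Mapping.keys a \<subseteq> S \<and> tdeg a = i)"
  using assms
proof (induction S rule: finite_induct)
  case empty
  show ?case
    using has_betti_zero_ideal[of K V] by (intro exI conjI) (auto split: if_splits)
next
  case (insert v S)
  define U where "U = {t :: 'v \<Rightarrow>\<^sub>0 nat. Poly_Mapping.keys t \<inter> S \<noteq> {}}"
  obtain B where B: "has_betti K V U B" "\<And>i a. B i a \<le> 1"
    "\<And>i a. B i a \<noteq> 0 \<Longrightarrow> Poly_Mapping.keys a \<subseteq> S \<and> tdeg a = i"
    using insert.IH insert.prems unfolding U_def by blast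
  define f where "f = Poly_Mapping.single v (1::nat)"
  have B0: "B i a = 0" if "f \<preceq> a" for i a
    using B(3)[of i a] that insert.hyps by (auto simp: f_def single_mdvd_iff simp del: One_nat_def)
  have colon: "{t. t + f \<in> U} = U"
    using insert.hyps by (auto simp: U_def f_def keys_add_nat)
  have hb: "has_betti K V {t. t + f \<in> U} B"
    unfolding colon by (rule B(1))
  have "has_betti K V (U \<union> {t. f \<preceq> t}) (cone_betti f B B)"
    using B(1) hb by (rule has_betti_cone) (use insert.prems B0 in \<open>auto simp: f_def simp del: One_nat_def\<close>)
  moreover have "U \<union> {t. f \<preceq> t} = {t. Poly_Mapping.keys t \<inter> insert v S \<noteq> {}}"
    by (auto simp: U_def f_def single_mdvd_iff simp del: One_nat_def)
  moreover have "cone_betti f B B i a \<le> 1" for i a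
    using B(2) B0 by (intro cone_betti_le) auto
  moreover have "Poly_Mapping.keys a \<subseteq> insert v S \<and> tdeg a = i" if "cone_betti f B B i a \<noteq> 0" for i a
    using cone_betti_nonzero[OF that]
  proof (elim disjE exE conjE)
    fix j b assume *: "i = Suc j" "a = b + f" "B j b \<noteq> 0"
    then show ?thesis
      using B(3)[of j b] by (auto simp: keys_add_nat tdeg_add f_def)
  qed (use B(3) in blast)
  ultimately show ?case
    by (simp only:) blast
qed

section \<open>Paths together with variables\<close>

text \<open>The support \<open>S\<close> serves to show that a new edge has a vertex in no old
  shift. The bound \<open>i \<le> tdeg a\<close>, though weak, exceeds the linear degree
  \<open>Suc i\<close> once an edge has been added to \<open>a\<close>.\<close>

definition thin :: "'k::field itself \<Rightarrow> 'v set \<Rightarrow> ('v \<Rightarrow>\<^sub>0 nat) set \<Rightarrow> 'v set \<Rightarrow> bool" where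
  "thin K V U S \<longleftrightarrow> (\<exists>B. has_betti K V U B \<and> (\<forall>i a. B i a \<le> 1) \<and>
     (\<forall>i a. B i a \<noteq> 0 \<longrightarrow> Poly_Mapping.keys a \<subseteq> S \<and> i \<le> tdeg a))"

lemma thin_mono: "thin K V U S \<Longrightarrow> S \<subseteq> S' \<Longrightarrow> thin K V U S'"
  unfolding thin_def by (meson subset_trans)

text \<open>The index counts vertices, so the set is empty for \<open>j \<le> 1\<close>;
  \<open>path_mon (l - 2)\<close> is therefore right even when the difference truncates.\<close>

definition path_mon :: "nat \<Rightarrow> (fan_vertex \<Rightarrow>\<^sub>0 nat) set" where
  "path_mon j = {t. \<exists>i. 1 \<le> i \<and> i < j \<and> Path i \<in> Poly_Mapping.keys t \<and> Path (Suc i) \<in> Poly_Mapping.keys t}"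

text \<open>Division by y_l turns the edge y_(l-1) y_l into the variable y_(l-1), which absorbs the
  edge y_(l-2) y_(l-1) and leaves the path on l - 2 vertices. For \<open>l = 1\<close> there is no
  neighbour y_0, hence the guard.\<close>

lemma path_mon_colon:
  assumes "l \<ge> 1"
  shows "t + edge_mon (Path l) (Path (Suc l)) \<in> path_mon l \<longleftrightarrow>
    t \<in> path_mon (l - 2) \<or> 2 \<le> l \<and> Path (l - 1) \<in> Poly_Mapping.keys t"
proof
  assume "t + edge_mon (Path l) (Path (Suc l)) \<in> path_mon l"
  then obtain i where i: "1 \<le> i" "i < l" "Path i \<in> Poly_Mapping.keys t"
    "Suc i = l \<or> Path (Suc i) \<in> Poly_Mapping.keys t"
    by (auto simp: path_mon_def keys_add_nat)
  show "t \<in> path_mon (l - 2) \<or> 2 \<le> l \<and> Path (l - 1) \<in> Poly_Mapping.keys t"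
  proof (cases "i < l - 2")
    case True
    then show ?thesis
      using i by (auto simp: path_mon_def)
  next
    case False
    then have "i = l - 1 \<or> Suc i = l - 1"
      using i by auto
    then show ?thesis
      using i by auto
  qed
next
  assume "t \<in> path_mon (l - 2) \<or> 2 \<le> l \<and> Path (l - 1) \<in> Poly_Mapping.keys t"
  then show "t + edge_mon (Path l) (Path (Suc l)) \<in> path_mon l"
  proof (elim disjE conjE)
    assume "2 \<le> l" "Path (l - 1) \<in> Poly_Mapping.keys t"
    then show ?thesis
      unfolding path_mon_def by (auto simp: keys_add_nat intro!: exI[of _ "l - 1"])
  qed (force simp: path_mon_def keys_add_nat)
qed

lemma path_mon_Suc:
  "l \<ge> 1 \<Longrightarrow> path_mon (Suc l) = path_mon l \<union> {t. edge_mon (Path l) (Path (Suc l)) \<preceq> t}"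
  by (auto simp: path_mon_def edge_mon_mdvd_iff less_Suc_eq)

text \<open>The same colon ideal arises when \<open>X\<close> consists of generators
  (\<open>thin_path\<close>) and when its elements become generators on division by a path vertex
  (\<open>fan_betti\<close>). The claim for shorter paths is an assumption, to be met by an
  induction hypothesis in one case and by \<open>thin_path\<close> in the other.\<close>

lemma thin_path_colon:
  assumes l: "l \<ge> 1" and V: "Path ` {1..l} \<subseteq> V" and X: "X \<subseteq> V" "X \<inter> Path ` {1..l} = {}"
    and IH: "\<And>X'. X' \<subseteq> V \<Longrightarrow> X' \<inter> Path ` {1..l - 2} = {} \<Longrightarrow>
      thin K V ({t. Poly_Mapping.keys t \<inter> X' \<noteq> {}} \<union> path_mon (l - 2)) (X' \<union> Path ` {1..l - 2})"
  shows "thin K V {t. Poly_Mapping.keys t \<inter> X \<noteq> {} \<or> t + edge_mon (Path l) (Path (Suc l)) \<in> path_mon l}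
    (X \<union> Path ` {1..l - 1})"
proof -
  define X' where "X' = (if 2 \<le> l then insert (Path (l - 1)) X else X)"
  have "{t. Poly_Mapping.keys t \<inter> X \<noteq> {} \<or> t + edge_mon (Path l) (Path (Suc l)) \<in> path_mon l} =
      {t. Poly_Mapping.keys t \<inter> X' \<noteq> {}} \<union> path_mon (l - 2)"
    unfolding path_mon_colon[OF l] X'_def by auto
  moreover have "thin K V ({t. Poly_Mapping.keys t \<inter> X' \<noteq> {}} \<union> path_mon (l - 2)) (X' \<union> Path ` {1..l - 2})"
  proof (rule IH)
    have "Path ` {1..l - 2} \<subseteq> Path ` {1..l}" "Path (l - 1) \<notin> Path ` {1..l - 2}"
      by auto
    then show "X' \<inter> Path ` {1..l - 2} = {}"
      using X(2) unfolding X'_def by (simp split: if_splits) blast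
    show "X' \<subseteq> V"
      using V X l by (auto simp: X'_def)
  qed
  moreover have "X' \<union> Path ` {1..l - 2} \<subseteq> X \<union> Path ` {1..l - 1}"
    by (auto simp: X'_def)
  ultimately show ?thesis
    using thin_mono by metis
qed

text \<open>The colon by the last edge involves a path with up to three vertices fewer, hence the
  strong induction. No old shift involves the last vertex, so the cone is minimal and the counts
  stay at most one.\<close>

lemma thin_path:
  assumes "finite V" "Path ` {1..j} \<subseteq> V" "X \<subseteq> V" "X \<inter> Path ` {1..j} = {}"
  shows "thin K V ({t. Poly_Mapping.keys t \<inter> X \<noteq> {}} \<union> path_mon j) (X \<union> Path ` {1..j})"
  using assms
proof (induction j arbitrary: X rule: less_induct)
  case (less j)
  show ?case
  proof (cases "j \<le> 1")
    case True
    then have "path_mon j = {}"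
      by (auto simp: path_mon_def)
    moreover have "finite X"
      using less.prems finite_subset by blast
    then have "thin K V {t. Poly_Mapping.keys t \<inter> X \<noteq> {}} X"
      using koszul_betti[of X V K] less.prems(3) unfolding thin_def by blast
    then have "thin K V {t. Poly_Mapping.keys t \<inter> X \<noteq> {}} (X \<union> Path ` {1..j})"
      by (rule thin_mono) simp
    ultimately show ?thesis
      by simp
  next
    case False
    then obtain l where l: "j = Suc l" "l \<ge> 1"
      by (cases j) auto
    define f where "f = edge_mon (Path l) (Path (Suc l))"
    define U where "U = {t. Poly_Mapping.keys t \<inter> X \<noteq> {}} \<union> path_mon l"
    have "thin K V U (X \<union> Path ` {1..l})"
      unfolding U_def using less.prems l by (intro less.IH) auto
    then obtain B where B: "has_betti K V U B" "\<And>i a. B i a \<le> 1"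
      "\<And>i a. B i a \<noteq> 0 \<Longrightarrow> Poly_Mapping.keys a \<subseteq> X \<union> Path ` {1..l} \<and> i \<le> tdeg a"
      unfolding thin_def by blast
    have "thin K V {t. Poly_Mapping.keys t \<inter> X \<noteq> {} \<or> t + f \<in> path_mon l} (X \<union> Path ` {1..l - 1})"
      unfolding f_def
    proof (rule thin_path_colon)
      have *: "Path ` {1..l} \<subseteq> Path ` {1..j}" "Path ` {1..l - 2} \<subseteq> Path ` {1..j}"
        using l by auto
      show "Path ` {1..l} \<subseteq> V" "X \<inter> Path ` {1..l} = {}"
        using * less.prems by blast+
      show "thin K V ({t. Poly_Mapping.keys t \<inter> X' \<noteq> {}} \<union> path_mon (l - 2)) (X' \<union> Path ` {1..l - 2})"
        if "X' \<subseteq> V" "X' \<inter> Path ` {1..l - 2} = {}" for X'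
      proof (rule less.IH)
        show "Path ` {1..l - 2} \<subseteq> V"
          using * less.prems by blast
      qed (use that less.prems l in simp_all)
    qed (use l less.prems in simp_all)
    also have "{t. Poly_Mapping.keys t \<inter> X \<noteq> {} \<or> t + f \<in> path_mon l} = {t. t + f \<in> U}"
      using less.prems l by (auto simp: U_def f_def keys_add_nat)
    finally obtain B' where B': "has_betti K V {t. t + f \<in> U} B'" "\<And>i a. B' i a \<le> 1"
      "\<And>i a. B' i a \<noteq> 0 \<Longrightarrow> Poly_Mapping.keys a \<subseteq> X \<union> Path ` {1..l - 1} \<and> i \<le> tdeg a"
      unfolding thin_def by blast
    have B0: "B i a = 0" if "f \<preceq> a" for i a
    proof (rule ccontr)
      assume "B i a \<noteq> 0"
      then have "Path j \<in> X \<union> Path ` {1..l}"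
        using B(3)[of i a] mdvd_keys[OF that] l by (auto simp: f_def)
      moreover have "Path j \<in> Path ` {1..j}" "Path j \<notin> Path ` {1..l}"
        using l by auto
      ultimately show False
        using less.prems(4) by blast
    qed
    have "has_betti K V (U \<union> {t. f \<preceq> t}) (cone_betti f B B')"
      using B(1) B'(1) by (rule has_betti_cone)
        (use less.prems(2) l B0 in \<open>auto simp: f_def intro!: edge_mon_multidegree\<close>)
    moreover have "U \<union> {t. f \<preceq> t} = {t. Poly_Mapping.keys t \<inter> X \<noteq> {}} \<union> path_mon j"
      using l by (auto simp: U_def f_def path_mon_Suc)
    moreover have "cone_betti f B B' i a \<le> 1" for i a
      using B(2) B'(2) B0 by (intro cone_betti_le) auto
    moreover have "Poly_Mapping.keys a \<subseteq> X \<union> Path ` {1..j} \<and> i \<le> tdeg a"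
      if "cone_betti f B B' i a \<noteq> 0" for i a
      using cone_betti_nonzero[OF that]
    proof (elim disjE exE conjE)
      assume "B i a \<noteq> 0"
      then show ?thesis
        using B(3)[of i a] l by auto
    next
      fix i' b assume *: "i = Suc i'" "a = b + f" "B' i' b \<noteq> 0"
      have "Path ` {1..l - 1} \<union> {Path l, Path (Suc l)} \<subseteq> Path ` {1..j}"
        using l by auto
      then have "Poly_Mapping.keys a \<subseteq> X \<union> Path ` {1..j}"
        using B'(3)[OF *(3)] unfolding *(2) keys_add_nat f_def keys_edge_mon by blast
      then show ?thesis
        using B'(3)[OF *(3)] * by (simp add: tdeg_add f_def)
    qed
    ultimately show ?thesis
      unfolding thin_def by (simp only:) blast
  qed
qed

section \<open>Complete bipartite graphs\<close>

text \<open>Every colon ideal is generated by variables, with Koszul shifts of degree i in position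
  i. The cone moves them to degree i + 2 in position i + 1, so linearity persists;
  \<open>a = 0\<close> accounts for the generator in position 0.\<close>

lemma bipartite_betti:
  fixes V :: "'v set"
  assumes "finite X" "finite Y" "X \<subseteq> V" "Y \<subseteq> V" "X \<inter> Y = {}"
  shows "\<exists>B. has_betti K V {t. Poly_Mapping.keys t \<inter> X \<noteq> {} \<and> Poly_Mapping.keys t \<inter> Y \<noteq> {}} B \<and>
    (\<forall>i a. B i a \<le> 1) \<and> (\<forall>i a. B i a \<noteq> 0 \<longrightarrow> Poly_Mapping.keys a \<subseteq> X \<union> Y \<and> (a = 0 \<or> tdeg a = Suc i))"
  using assms
proof (induction X rule: finite_induct)
  case empty
  show ?case
    using has_betti_zero_ideal[of K V] by (intro exI conjI) (auto split: if_splits)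
next
  case (insert x S)
  \<comment> \<open>The stage reached when \<open>x\<close> has been multiplied with
    \<open>T\<close> and all of \<open>S\<close> with \<open>Y\<close>. Its colon by the next
    product x y is generated by \<open>S\<close> (through y) and \<open>T\<close> (through
    x).\<close>
  define U where "U = (\<lambda>T. {t :: 'v \<Rightarrow>\<^sub>0 nat. (Poly_Mapping.keys t \<inter> S \<noteq> {} \<and> Poly_Mapping.keys t \<inter> Y \<noteq> {}) \<or>
    (x \<in> Poly_Mapping.keys t \<and> Poly_Mapping.keys t \<inter> T \<noteq> {})})"
  \<comment> \<open>The clause on \<open>x\<close> ensures that no old shift is divisible by the
    next product, whose second factor lies outside \<open>T\<close>.\<close>
  have "\<exists>B. has_betti K V (U T) B \<and> (\<forall>i a. B i a \<le> 1) \<and>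
      (\<forall>i a. B i a \<noteq> 0 \<longrightarrow> Poly_Mapping.keys a \<subseteq> insert x S \<union> Y \<and>
        (x \<in> Poly_Mapping.keys a \<longrightarrow> Poly_Mapping.keys a \<inter> Y \<subseteq> T) \<and> (a = 0 \<or> tdeg a = Suc i))"
    if "finite T" "T \<subseteq> Y" for T
    using that
  proof (induction T rule: finite_induct)
    case empty
    obtain B where "has_betti K V (U {}) B" "\<And>i a. B i a \<le> 1"
      "\<And>i a. B i a \<noteq> 0 \<Longrightarrow> Poly_Mapping.keys a \<subseteq> S \<union> Y \<and> (a = 0 \<or> tdeg a = Suc i)"
      using insert.IH insert.prems by (auto simp: U_def)
    then show ?case
      using insert.hyps insert.prems by (intro exI[of _ B]) blast
  next
    case (insert y T)
    note outer = \<open>finite S\<close> \<open>x \<notin> S\<close> \<open>insert x S \<subseteq> V\<close> \<open>Y \<subseteq> V\<close> \<open>insert x S \<inter> Y = {}\<close>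
    obtain B where B: "has_betti K V (U T) B" "\<And>i a. B i a \<le> 1"
      "\<And>i a. B i a \<noteq> 0 \<Longrightarrow> Poly_Mapping.keys a \<subseteq> insert x S \<union> Y \<and>
        (x \<in> Poly_Mapping.keys a \<longrightarrow> Poly_Mapping.keys a \<inter> Y \<subseteq> T) \<and> (a = 0 \<or> tdeg a = Suc i)"
      using insert.IH insert.prems by blast
    obtain B' where B': "has_betti K V {t. Poly_Mapping.keys t \<inter> (S \<union> T) \<noteq> {}} B'" "\<And>i a. B' i a \<le> 1"
      "\<And>i a. B' i a \<noteq> 0 \<Longrightarrow> Poly_Mapping.keys a \<subseteq> S \<union> T \<and> tdeg a = i"
    proof -
      have "finite (S \<union> T)" "S \<union> T \<subseteq> V"
        using insert.hyps insert.prems outer by auto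
      then show ?thesis
        using koszul_betti[of "S \<union> T" V K] that by blast
    qed
    define f where "f = edge_mon x y"
    have xy: "x \<noteq> y"
      using insert.prems outer by auto
    have "{t. Poly_Mapping.keys t \<inter> (S \<union> T) \<noteq> {}} = {t. t + f \<in> U T}"
      using insert.hyps insert.prems outer by (auto simp: U_def f_def keys_add_nat)
    then have hb: "has_betti K V {t. t + f \<in> U T} B'"
      using B'(1) by simp
    have B0: "B i a = 0" if "f \<preceq> a" for i a
      using B(3)[of i a] mdvd_keys[OF that] insert.hyps insert.prems by (auto simp: f_def)
    have "has_betti K V (U T \<union> {t. f \<preceq> t}) (cone_betti f B B')"
      using B(1) hb by (rule has_betti_cone)
        (use outer insert.prems B0 in \<open>auto simp: f_def intro!: edge_mon_multidegree\<close>)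
    moreover have "U T \<union> {t. f \<preceq> t} = U (insert y T)"
      using xy by (auto simp: U_def f_def edge_mon_mdvd_iff)
    moreover have "cone_betti f B B' i a \<le> 1" for i a
      using B(2) B'(2) B0 by (intro cone_betti_le) auto
    moreover have "Poly_Mapping.keys a \<subseteq> insert x S \<union> Y \<and>
        (x \<in> Poly_Mapping.keys a \<longrightarrow> Poly_Mapping.keys a \<inter> Y \<subseteq> insert y T) \<and> (a = 0 \<or> tdeg a = Suc i)"
      if "cone_betti f B B' i a \<noteq> 0" for i a
      using cone_betti_nonzero[OF that]
    proof (elim disjE exE conjE)
      assume "B i a \<noteq> 0"
      then show ?thesis
        using B(3)[of i a] by auto
    next
      fix i' b assume *: "i = Suc i'" "a = b + f" "B' i' b \<noteq> 0"
      then have "Poly_Mapping.keys a \<subseteq> insert x (insert y (S \<union> T))" "tdeg a = Suc i"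
        using B'(3)[of i' b] by (auto simp: keys_add_nat tdeg_add f_def)
      then show ?thesis
        using insert.prems outer by auto
    qed
    ultimately show ?case
      by (simp only:) blast
  qed
  from this[OF \<open>finite Y\<close> subset_refl] obtain B where "has_betti K V (U Y) B" "\<And>i a. B i a \<le> 1"
    "\<And>i a. B i a \<noteq> 0 \<Longrightarrow> Poly_Mapping.keys a \<subseteq> insert x S \<union> Y \<and> (a = 0 \<or> tdeg a = Suc i)"
    by blast
  moreover have "U Y = {t. Poly_Mapping.keys t \<inter> insert x S \<noteq> {} \<and> Poly_Mapping.keys t \<inter> Y \<noteq> {}}"
    by (auto simp: U_def)
  ultimately show ?case
    by (intro exI[of _ B]) auto
qed

text \<open>
  The invariant excludes cancellation: with \<open>y\<^sub>1, y\<^sub>2, \<dots>\<close> for the path vertices, before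
  \<open>y\<^sub>j y\<^sub>j\<^sub>+\<^sub>1\<close> is adjoined, a shift \<open>a\<close> in position \<open>i\<close> divisible by \<open>y\<^sub>j\<^sub>+\<^sub>1\<close> has
  total degree \<open>i + 1\<close>, while the shifts of the twisted resolution in position \<open>i\<close> have
  total degree at least \<open>i + 2\<close>.
\<close>

lemma fan_betti:
  assumes V: "finite V" "Path ` {1..n} \<subseteq> V" and X: "X \<subseteq> V" "X \<inter> Path ` {1..n} = {}" and "j \<le> n"
  shows "\<exists>B. has_betti K V ({t. Poly_Mapping.keys t \<inter> X \<noteq> {} \<and> Poly_Mapping.keys t \<inter> Path ` {1..n} \<noteq> {}} \<union>
      path_mon j) B \<and> (\<forall>i a. B i a \<le> 2) \<and>
    (\<forall>i a l. j < l \<and> l \<le> n \<and> Path l \<in> Poly_Mapping.keys a \<and> B i a \<noteq> 0 \<longrightarrow> B i a = 1 \<and> tdeg a = Suc i)"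
  using \<open>j \<le> n\<close>
proof (induction j)
  case 0
  have "finite X"
    using V(1) X(1) finite_subset by blast
  then obtain B where B: "has_betti K V {t. Poly_Mapping.keys t \<inter> X \<noteq> {} \<and>
      Poly_Mapping.keys t \<inter> Path ` {1..n} \<noteq> {}} B" "\<And>i a. B i a \<le> 1"
    "\<And>i a. B i a \<noteq> 0 \<Longrightarrow> a = 0 \<or> tdeg a = Suc i"
    using bipartite_betti[of X "Path ` {1..n}" V K] V X by auto
  have "B i a \<le> 2" for i a
    using B(2)[of i a] by simp
  moreover have "path_mon 0 = {}"
    by (simp add: path_mon_def)
  moreover have "B i a = 1 \<and> tdeg a = Suc i" if "Path l \<in> Poly_Mapping.keys a" "B i a \<noteq> 0" for i a l
    using B(2)[of i a] B(3)[of i a] that by auto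
  ultimately show ?case
    using B(1) by (intro exI[of _ B]) (simp only: Un_empty_right, blast)
next
  case (Suc j)
  define U where "U = {t. Poly_Mapping.keys t \<inter> X \<noteq> {} \<and> Poly_Mapping.keys t \<inter> Path ` {1..n} \<noteq> {}} \<union> path_mon j"
  obtain B where B: "has_betti K V U B" "\<And>i a. B i a \<le> 2"
    "\<And>i a l. j < l \<Longrightarrow> l \<le> n \<Longrightarrow> Path l \<in> Poly_Mapping.keys a \<Longrightarrow> B i a \<noteq> 0 \<Longrightarrow> B i a = 1 \<and> tdeg a = Suc i"
    using Suc unfolding U_def by (metis (no_types, lifting) Suc_leD)
  show ?case
  proof (cases "j = 0")
    case True
    \<comment> \<open>A path on one vertex has no edge, so nothing is adjoined.\<close>
    then have "path_mon (Suc j) = path_mon j"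
      by (auto simp: path_mon_def)
    moreover have "B i a = 1 \<and> tdeg a = Suc i"
      if "Suc j < l" "l \<le> n" "Path l \<in> Poly_Mapping.keys a" "B i a \<noteq> 0" for i a l
      using B(3)[of l a i] that by simp
    ultimately show ?thesis
      using B(1,2) unfolding U_def by (intro exI[of _ B]) (simp only:, blast)
  next
    case False
    define f where "f = edge_mon (Path j) (Path (Suc j))"
    have "thin K V {t. Poly_Mapping.keys t \<inter> X \<noteq> {} \<or> t + f \<in> path_mon j} (X \<union> Path ` {1..j - 1})"
      unfolding f_def
    proof (rule thin_path_colon)
      have *: "Path ` {1..j} \<subseteq> Path ` {1..n}" "Path ` {1..j - 2} \<subseteq> Path ` {1..n}"
        using Suc.prems by auto
      show "Path ` {1..j} \<subseteq> V" "X \<inter> Path ` {1..j} = {}"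
        using * V X by blast+
      show "thin K V ({t. Poly_Mapping.keys t \<inter> X' \<noteq> {}} \<union> path_mon (j - 2)) (X' \<union> Path ` {1..j - 2})"
        if "X' \<subseteq> V" "X' \<inter> Path ` {1..j - 2} = {}" for X'
        using V(1) _ that
      proof (rule thin_path)
        show "Path ` {1..j - 2} \<subseteq> V"
          using * V by blast
      qed
    qed (use False X in simp_all)
    \<comment> \<open>The factor \<open>f\<close> supplies a path vertex, so the products of
      \<open>X\<close> with the path reduce to the variables in \<open>X\<close>.\<close>
    also have "{t. Poly_Mapping.keys t \<inter> X \<noteq> {} \<or> t + f \<in> path_mon j} = {t. t + f \<in> U}"
      using Suc.prems X(2) False by (auto simp: U_def f_def keys_add_nat)
    finally obtain B' where B': "has_betti K V {t. t + f \<in> U} B'" "\<And>i a. B' i a \<le> 1"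
      "\<And>i a. B' i a \<noteq> 0 \<Longrightarrow> Poly_Mapping.keys a \<subseteq> X \<union> Path ` {1..j - 1} \<and> i \<le> tdeg a"
      unfolding thin_def by blast
    \<comment> \<open>The invariant at \<open>l = Suc j\<close> leaves room for one new summand and
      fixes the degree.\<close>
    have B1: "B i a \<le> 1 \<and> (B i a \<noteq> 0 \<longrightarrow> tdeg a = Suc i)" if "f \<preceq> a" for i a
      using B(3)[of "Suc j" a i] Suc.prems mdvd_keys[OF that] by (cases "B i a = 0") (auto simp: f_def)
    have "B i (a + f) = 0 \<or> B' i a = 0" for i a
      using B1[of "a + f" i] B'(3)[of i a] by (auto simp: tdeg_add f_def)
    then have "has_betti K V (U \<union> {t. f \<preceq> t}) (cone_betti f B B')"
      using Suc.prems V(2) False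
      by (intro has_betti_cone[OF B(1) B'(1)]) (auto simp: f_def intro!: edge_mon_multidegree)
    moreover have "U \<union> {t. f \<preceq> t} = {t. Poly_Mapping.keys t \<inter> X \<noteq> {} \<and>
        Poly_Mapping.keys t \<inter> Path ` {1..n} \<noteq> {}} \<union> path_mon (Suc j)"
      using False by (auto simp: U_def f_def path_mon_Suc)
    moreover have "cone_betti f B B' i a \<le> 2" for i a
      using B(2) B'(2) B1 by (intro cone_betti_le) auto
    moreover have "cone_betti f B B' i a = 1 \<and> tdeg a = Suc i"
      if l: "Suc j < l" "l \<le> n" "Path l \<in> Poly_Mapping.keys a" and nz: "cone_betti f B B' i a \<noteq> 0" for i a l
    proof -
      \<comment> \<open>Shifts from the new edge involve no path vertex beyond y_(j+1), so the
        invariant for larger \<open>l\<close> is inherited from \<open>B\<close>.\<close>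
      have "B' (i - 1) (a - f) = 0" if "f \<preceq> a"
      proof (rule ccontr)
        assume "B' (i - 1) (a - f) \<noteq> 0"
        then have "Poly_Mapping.keys (a - f + f) \<subseteq> X \<union> Path ` {1..j - 1} \<union> {Path j, Path (Suc j)}"
          using B'(3)[of "i - 1" "a - f"] by (auto simp: keys_add_nat f_def)
        then have "Path l \<in> X"
          using l that by (auto simp: mdvd_diff_add)
        then show False
          using X(2) l by auto
      qed
      then have "cone_betti f B B' i a = B i a"
        by (simp add: cone_betti_def)
      then show ?thesis
        using B(3)[of l a i] l nz by simp
    qed
    ultimately show ?thesis
      by (simp only:) blast
  qed
qed

section \<open>The edge ideal of the fan\<close>

text \<open>Without loops the generators are squarefree, so divisibility by them depends only on the
  support.\<close>

lemma edge_ideal_eq: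
  assumes edges: "\<And>u v. {u, v} \<in> edges G \<Longrightarrow> u \<noteq> v \<and> u \<in> verts G \<and> v \<in> verts G"
  shows "edge_ideal G = (mono_ideal (verts G) {t. \<exists>u v. {u, v} \<in> edges G \<and>
    u \<in> Poly_Mapping.keys t \<and> v \<in> Poly_Mapping.keys t} :: ('v, 'k::field) poly_over set)"
proof -
  define M where "M = {edge_mon u v | u v. {u, v} \<in> edges G}"
  have "{var u * var v | u v. {u, v} \<in> edges G} =
      ((\<lambda>m. Poly_Mapping.single m 1) ` M :: ('v, 'k) poly_over set)"
    by (auto simp: M_def var_def edge_mon_def mult_single)
  moreover have "M \<subseteq> multidegrees (verts G)"
    using edges by (auto simp: M_def intro!: edge_mon_multidegree)
  ultimately have "edge_ideal G =
      (mono_ideal (verts G) {t. \<exists>m\<in>M. m \<preceq> t} :: ('v, 'k) poly_over set)"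
    unfolding edge_ideal_def by (simp only: ideal_gen_monomials)
  also have "{t. \<exists>m\<in>M. m \<preceq> t} = {t. \<exists>u v. {u, v} \<in> edges G \<and>
      u \<in> Poly_Mapping.keys t \<and> v \<in> Poly_Mapping.keys t}"
  proof (rule Collect_cong)
    fix t
    have "(\<exists>m\<in>M. m \<preceq> t) \<longleftrightarrow> (\<exists>u v. {u, v} \<in> edges G \<and> edge_mon u v \<preceq> t)"
      unfolding M_def by blast
    also have "\<dots> \<longleftrightarrow> (\<exists>u v. {u, v} \<in> edges G \<and> u \<in> Poly_Mapping.keys t \<and> v \<in> Poly_Mapping.keys t)"
      using edges by (intro ex_cong1 conj_cong refl edge_mon_mdvd_iff) simp
    finally show "(\<exists>m\<in>M. m \<preceq> t) \<longleftrightarrow>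
        (\<exists>u v. {u, v} \<in> edges G \<and> u \<in> Poly_Mapping.keys t \<and> v \<in> Poly_Mapping.keys t)" .
  qed
  finally show ?thesis .
qed

lemma fan_graph_verts: "verts (fan_graph m n) = Apex ` {1..m} \<union> Path ` {1..n}"
  and fan_graph_edges: "edges (fan_graph m n) = {{Path i, Path (Suc i)} | i. 1 \<le> i \<and> i < n} \<union>
    {{Apex i, Path j} | i j. i \<in> {1..m} \<and> j \<in> {1..n}}"
proof -
  \<comment> \<open>The joined set \<open>W\<close> stays fixed while the graph grows; in the fan it
    is the vertex set of the path, so apices are not joined to each other.\<close>
  have "verts (foldr (\<lambda>i. join_vertex (Apex i) W) xs H) = Apex ` set xs \<union> verts H \<and>
      edges (foldr (\<lambda>i. join_vertex (Apex i) W) xs H) = edges H \<union> {{Apex i, u} | i u. i \<in> set xs \<and> u \<in> W}"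
    for W xs H
    by (induction xs) (auto simp: join_vertex_def)
  note foldr = this
  have "verts (path_graph n) = Path ` {1..n}"
    "edges (path_graph n) = {{Path i, Path (Suc i)} | i. 1 \<le> i \<and> i < n}" "set [1..<Suc m] = {1..m}"
    by (auto simp: path_graph_def)
  then show "verts (fan_graph m n) = Apex ` {1..m} \<union> Path ` {1..n}"
    "edges (fan_graph m n) = {{Path i, Path (Suc i)} | i. 1 \<le> i \<and> i < n} \<union>
      {{Apex i, Path j} | i j. i \<in> {1..m} \<and> j \<in> {1..n}}"
    unfolding fan_graph_def by (simp_all only: foldr) blast
qed

theorem corollary4p4:
  fixes m n i :: nat and a :: "fan_vertex \<Rightarrow>\<^sub>0 nat"
  assumes "n \<ge> 2" and "m \<ge> 1" and "i \<ge> 1"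
    and "a \<in> multidegrees (verts (fan_graph m n))"
  shows "betti (verts (fan_graph m n))
           (edge_ideal (fan_graph m n) :: (fan_vertex, 'k::field) poly_over set) i a \<le> 2"
proof -
  let ?G = "fan_graph m n" and ?Y = "Path ` {1..n}"
  let ?X = "Apex ` {1..m}"
  let ?U = "{t. Poly_Mapping.keys t \<inter> ?X \<noteq> {} \<and> Poly_Mapping.keys t \<inter> ?Y \<noteq> {}} \<union> path_mon n"
  have "edge_ideal ?G = (mono_ideal (verts ?G) {t. \<exists>u v. {u, v} \<in> edges ?G \<and>
      u \<in> Poly_Mapping.keys t \<and> v \<in> Poly_Mapping.keys t} :: (fan_vertex, 'k) poly_over set)"
    by (rule edge_ideal_eq) (auto simp: fan_graph_edges fan_graph_verts doubleton_eq_iff)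
  also have "{t. \<exists>u v. {u, v} \<in> edges ?G \<and> u \<in> Poly_Mapping.keys t \<and> v \<in> Poly_Mapping.keys t} = ?U"
    unfolding fan_graph_edges path_mon_def by (fastforce simp: doubleton_eq_iff)
  finally have I: "edge_ideal ?G = (mono_ideal (verts ?G) ?U :: (fan_vertex, 'k) poly_over set)" .
  have "finite (verts ?G)" "?Y \<subseteq> verts ?G" "?X \<subseteq> verts ?G" "?X \<inter> ?Y = {}"
    by (auto simp: fan_graph_verts)
  \<comment> \<open>At \<open>j = n\<close> all path edges are present and the degree invariant is
    vacuous; the bound remains.\<close>
  from fan_betti[OF this le_refl, of "TYPE('k)"]
  obtain B where "has_betti TYPE('k) (verts ?G) ?U B" "\<And>i a. B i a \<le> 2"
    by blast
  then show ?thesis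
    by (simp add: I betti_eq)
qed

end
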